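(* Let $1\le p<\infty$ and let $\mathbb{F}\in\{\mathbb{R},\mathbb{C}\}$. Then the multiplication in the Banach algebra $BV_p[0,1]$ is an open bilinear mapping. That is, for every pair $(F,G)\in (BV_p[0,1])^2$ and every $\varepsilon>0$ there exists $\delta>0$ such that \[ B(F G,\delta)\subset B(F,\varepsilon)\cdot B(G,\varepsilon):=\{c\, d:\ c\in B(F,\varepsilon),\ d\in B(G,\varepsilon)\}, \] where $B(a,r):=\{b\in BV_p[0,1]:\|a-b\|_{BV_p}<r\}$.
   Context: For $0\le\alpha\le\beta\le1$, a partition of $[\alpha,\beta]$ is a finite set $P=\{t_0,\dots,t_m\}$ with $\alpha=t_0<t_1<\dots<t_m=\beta$. For $1\le p<\infty$ and $f:[\alpha,\beta]\to\mathbb{F}$, $\mathbb{F}\in\{\mathbb{R},\mathbb{C}\}$, set $\operatorname{Var}_p(f,P,[\alpha,\beta]):=\sum_{j=1}^m|f(t_j)-f(t_{j-1})|^p$ and $\operatorname{Var}_p(f,[\alpha,\beta]):=\sup_P \operatorname{Var}_p(f,P,[\alpha,\beta])$ (the total Wiener $p$-variation). $BV_p[0,1]$ is the set of functions $f:[0,1]\to\mathbb{F}$ with $\operatorname{Var}_p(f,[0,1])<\infty$; it is a Banach algebra under pointwise multiplication with the norm $\|f\|_{BV_p}:=\|f\|_\infty+(\operatorname{Var}_p(f,[0,1]))^{1/p}$, where $\|f\|_\infty:=\sup_{x\in[0,1]}|f(x)|$. Multiplication in a Banach algebra $\mathcal{A}$ is locally open at $(a,b)\in\mathcal{A}^2$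 if for every $\varepsilon>0$ there is $\delta>0$ with $B_{\mathcal A}(ab,\delta)\subset B_{\mathcal A}(a,\varepsilon)\cdot B_{\mathcal A}(b,\varepsilon)$; it is an open bilinear mapping if it is locally open at every pair. *)

theory Defs
  imports "HOL-Analysis.Analysis"
begin

definition is_partition :: "real \<Rightarrow> real \<Rightarrow> real list \<Rightarrow> bool" where
  "is_partition a b ts \<longleftrightarrow> ts \<noteq> [] \<and> sorted_wrt (<) ts \<and> hd ts = a \<and> last ts = b"

definition var_p_part :: "real \<Rightarrow> (real \<Rightarrow> 'a::real_normed_vector) \<Rightarrow> real list \<Rightarrow> real" where
  "var_p_part p f ts = (\<Sum>j\<in>{1..<length ts}. norm (f (ts ! j) - f (ts ! (j - 1))) powr p)"

definition var_p :: "real \<Rightarrow> (real \<Rightarrow> 'a::real_normed_vector) \<Rightarrow> real \<Rightarrow> real \<Rightarrow> ereal" where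
  "var_p p f a b = (SUP ts \<in> {ts. is_partition a b ts}. ereal (var_p_part p f ts))"

text \<open>BV_p[0,1]: functions on [0,1] (represented extensionally, i.e. zero outside [0,1])
  of finite total p-variation.\<close>
definition BVp :: "real \<Rightarrow> (real \<Rightarrow> 'a::real_normed_vector) set" where
  "BVp p = {f. (\<forall>x. x \<notin> {0..1} \<longrightarrow> f x = 0) \<and> var_p p f 0 1 < \<infinity>}"

definition sup_norm :: "(real \<Rightarrow> 'a::real_normed_vector) \<Rightarrow> real" where
  "sup_norm f = (SUP x\<in>{0..1}. norm (f x))"

definition bvp_norm :: "real \<Rightarrow> (real \<Rightarrow> 'a::real_normed_vector) \<Rightarrow> real" where
  "bvp_norm p f = sup_norm f + (real_of_ereal (var_p p f 0 1)) powr (1 / p)"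

definition bvp_ball :: "real \<Rightarrow> (real \<Rightarrow> 'a::real_normed_vector) \<Rightarrow> real \<Rightarrow> (real \<Rightarrow> 'a) set" where
  "bvp_ball p a r = {b \<in> BVp p. bvp_norm p (\<lambda>x. a x - b x) < r}"

definition bvp_mult_open :: "real \<Rightarrow> (real \<Rightarrow> 'a::real_normed_field) itself \<Rightarrow> bool" where
  "bvp_mult_open p _ \<longleftrightarrow>
     (\<forall>F\<in>(BVp p :: (real \<Rightarrow> 'a) set). \<forall>G\<in>BVp p. \<forall>\<epsilon>>0. \<exists>\<delta>>0.
        bvp_ball p (\<lambda>x. F x * G x) \<delta> \<subseteq>
          {(\<lambda>x. c x * d x) | c d. c \<in> bvp_ball p F \<epsilon> \<and> d \<in> bvp_ball p G \<epsilon>})"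

end

theory Submission
  imports Defs
begin

text \<open>
  If \<open>\<bar>F\<bar> + \<bar>G\<bar>\<close> is bounded away from \<open>0\<close>, a small perturbation \<open>h\<close> of \<open>F G\<close> is absorbed by
  \<open>(F + t k(G)) (G + t k(F))\<close>, where \<open>k\<close> is conjugation and \<open>t\<close> is the small root of
  \<open>t (\<bar>F\<bar>\<^sup>2 + \<bar>G\<bar>\<^sup>2) + t\<^sup>2 k(F) k(G) = h\<close>; the variation of \<open>t\<close> is controlled by that of \<open>h\<close>.
  The general case reduces to this one: there are \<open>F'\<close>, \<open>G'\<close> arbitrarily close to \<open>F\<close>, \<open>G\<close> with
  \<open>F' G' = F G\<close> and \<open>\<bar>F'\<bar> + \<bar>G'\<bar>\<close> bounded below, obtained by putting \<open>F' = r\<close> and \<open>G' = F G / r\<close>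
  on a set where both functions are at most \<open>2 r\<close>.  What makes the modification small is that
  \<open>Var\<^sub>p (min f r)\<close> tends to \<open>0\<close> with \<open>r\<close> for every \<open>f \<ge> 0\<close> of finite \<open>p\<close>-variation, because
  \<open>Var\<^sub>p (min f r) + Var\<^sub>p (max (f - r) 0) \<le> Var\<^sub>p f\<close>.
\<close>

section \<open>Variation of positive and negative parts\<close>

text \<open>Write \<open>x powr p\<close> as \<open>x * x powr (p - 1)\<close>; the second factor is
  nondecreasing because \<open>1 \<le> p\<close>.\<close>

lemma powr_superadditive:
  fixes a b p :: real
  assumes "0 \<le> a" "0 \<le> b" "1 \<le> p"
  shows "a powr p + b powr p \<le> (a + b) powr p"
proof -
  have split: "x powr p = x * x powr (p - 1)" if "0 \<le> x" for x :: real
    using that by (cases "x = 0") (auto simp: powr_mult_base)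
  have "a powr p + b powr p = a * a powr (p - 1) + b * b powr (p - 1)"
    using assms split by simp
  also have "\<dots> \<le> a * (a + b) powr (p - 1) + b * (a + b) powr (p - 1)"
    using assms by (intro add_mono mult_left_mono powr_mono2) auto
  also have "\<dots> = (a + b) powr p"
    using assms split[of "a + b"] by (simp add: algebra_simps)
  finally show ?thesis .
qed

lemma powr_sum_le:
  fixes a b p :: real
  assumes "0 \<le> a" "0 \<le> b" "0 \<le> p"
  shows "(a + b) powr p \<le> 2 powr p * (a powr p + b powr p)"
proof -
  have "(a + b) powr p \<le> (2 * max a b) powr p"
    using assms by (intro powr_mono2) auto
  also have "\<dots> = 2 powr p * max a b powr p"
    using assms by (simp add: powr_mult)
  also have "\<dots> \<le> 2 powr p * (a powr p + b powr p)"
    by (intro mult_left_mono) (auto simp: max_def)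
  finally show ?thesis .
qed

text \<open>The increment \<open>d\<close> is arbitrary because majorants such as
  \<open>inc f x y + inc g x y\<close> need not be increments of a single function. The current
  point is a separate argument so that inductions can vary it.\<close>

fun inc_sum :: "real \<Rightarrow> ('b \<Rightarrow> 'b \<Rightarrow> real) \<Rightarrow> 'b \<Rightarrow> 'b list \<Rightarrow> real" where
  "inc_sum p d t [] = 0"
| "inc_sum p d t (u # us) = d t u powr p + inc_sum p d u us"

text \<open>The starting value is a free real number, not tied to a point of the domain; the
  inductions below exploit this.\<close>

abbreviation path_var :: "real \<Rightarrow> real \<Rightarrow> real list \<Rightarrow> real" where
  "path_var p \<equiv> inc_sum p (\<lambda>x y. \<bar>x - y\<bar>)"

abbreviation inc :: "(real \<Rightarrow> 'a::real_normed_vector) \<Rightarrow> real \<Rightarrow> real \<Rightarrow> real" where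
  "inc f \<equiv> \<lambda>x y. norm (f x - f y)"

lemma inc_sum_nonneg: "0 \<le> inc_sum p d t us"
  by (induction us arbitrary: t) auto

lemma inc_sum_append: "inc_sum p d t us \<le> inc_sum p d t (us @ vs)"
  by (induction us arbitrary: t) (auto simp: inc_sum_nonneg)

lemma inc_sum_map:
  fixes f :: "real \<Rightarrow> real"
  shows "inc_sum p (inc f) t us = path_var p (f t) (map f us)"
  by (induction us arbitrary: t) auto

text \<open>A nonnegative path only gains from a detour through \<open>0\<close>, since
  \<open>\<bar>a - x\<bar> \<le> max a x\<close>.\<close>

lemma path_var_via_zero:
  assumes "0 \<le> a" "\<And>x. x \<in> set xs \<Longrightarrow> 0 \<le> x" "0 \<le> p"
  shows "path_var p a xs \<le> a powr p + path_var p 0 xs"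
proof (cases xs)
  case (Cons x xs')
  have "\<bar>a - x\<bar> powr p \<le> max a x powr p"
    using assms(1,3) assms(2)[of x] Cons by (intro powr_mono2) auto
  also have "\<dots> \<le> a powr p + x powr p"
    by (auto simp: max_def)
  finally show ?thesis using assms Cons by auto
qed auto

text \<open>The two partitions \<open>filter A ts\<close> and \<open>filter B ts\<close> may be different.  They can be merged
  because the variation of a positive part only grows when a zero is inserted wherever the
  function is negative, and symmetrically for the negative part.\<close>

lemma path_var_pos_neg_parts:
  fixes g :: "real \<Rightarrow> real"
  assumes "1 \<le> p" "sorted_wrt (<) ts" "0 \<le> a"
  shows "\<exists>S. sorted_wrt (<) S \<and> set S \<subseteq> set ts \<and>
    path_var p a (map (\<lambda>x. max (g x) 0) (filter A ts)) +
    path_var p 0 (map (\<lambda>x. max (- g x) 0) (filter B ts)) \<le> path_var p a (map g S)"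
  using assms(2,3)
proof (induction ts arbitrary: g a A B)
  case Nil
  then show ?case by (intro exI[of _ "[]"]) auto
next
  case (Cons x ts)
  let ?P = "\<lambda>g. map (\<lambda>x. max (g x) 0) (filter A ts)"
  let ?N = "\<lambda>g. map (\<lambda>x. max (- g x) 0) (filter B ts)"
  have srt: "sorted_wrt (<) ts" and gt: "\<And>y. y \<in> set ts \<Longrightarrow> x < y"
    using Cons.prems by auto
  have "path_var p b (map g S) = path_var p (- b) (map (\<lambda>x. - g x) S)" for b S
    by (induction S arbitrary: b) (auto simp: abs_minus_commute)
  from this[of "- b" for b]
  have pvneg: "path_var p (- b) (map g S) = path_var p b (map (\<lambda>x. - g x) S)" for b S
    by simp
  \<comment> \<open>The new chain is \<open>S\<close> or \<open>x # S\<close>; each case below only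
    has to supply one of the two estimates.\<close>
  have ok: "\<exists>S. sorted_wrt (<) S \<and> set S \<subseteq> set (x # ts) \<and> C \<le> path_var p a (map g S)"
    if "sorted_wrt (<) S" "set S \<subseteq> set ts"
      "C \<le> path_var p a (map g S) \<or> C \<le> \<bar>a - g x\<bar> powr p + path_var p (g x) (map g S)" for S C
    using that(3)
  proof
    assume "C \<le> path_var p a (map g S)"
    then show ?thesis using that by (intro exI[of _ S]) auto
  next
    assume "C \<le> \<bar>a - g x\<bar> powr p + path_var p (g x) (map g S)"
    then show ?thesis using that gt by (intro exI[of _ "x # S"]) auto
  qed
  show ?case
  proof (cases "0 \<le> g x")
    \<comment> \<open>Here \<open>x\<close> leaves the negative-part path at \<open>0\<close>
      whatever \<open>B x\<close> is, so \<open>x\<close> is kept exactly when \<open>A x\<close>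
      holds.\<close>
    case True
    show ?thesis
    proof (cases "A x")
      case Ax: True
      obtain S where "sorted_wrt (<) S" "set S \<subseteq> set ts"
        "path_var p (g x) (?P g) + path_var p 0 (?N g) \<le> path_var p (g x) (map g S)"
        using Cons.IH[OF srt True] by blast
      then show ?thesis using ok[of S] Ax True by (auto simp: max_def)
    next
      case Ax: False
      obtain S where "sorted_wrt (<) S" "set S \<subseteq> set ts"
        "path_var p a (?P g) + path_var p 0 (?N g) \<le> path_var p a (map g S)"
        using Cons.IH[OF srt Cons.prems(2)] by blast
      then show ?thesis using ok[of S] Ax True by (auto simp: max_def)
    qed
  next
    case False
    define b where "b = - g x"
    have b: "0 < b" "g x = - b" using False by (auto simp: b_def)
    \<comment> \<open>A jump across zero is worth at least the two separate moves to zero and away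
      from it.\<close>
    have sup: "a powr p + b powr p \<le> \<bar>a - g x\<bar> powr p"
      using powr_superadditive[of a b p] assms(1) b Cons.prems(2) by simp
    show ?thesis
    proof (cases "B x")
      case Bx: True
      \<comment> \<open>Past \<open>x\<close> the signs are exchanged: the induction hypothesis is
        used for \<open>- g\<close> with \<open>A\<close> and \<open>B\<close> swapped, and the
        positive-part path restarts at \<open>0\<close>.\<close>
      obtain S where S: "sorted_wrt (<) S" "set S \<subseteq> set ts"
        "path_var p b (?N g) + path_var p 0 (?P g) \<le> path_var p b (map (\<lambda>x. - g x) S)"
        using Cons.IH[OF srt, of b "\<lambda>x. - g x" B A] b by auto
      have "path_var p a (?P g) \<le> a powr p + path_var p 0 (?P g)"
        using assms(1) Cons.prems(2) by (intro path_var_via_zero) auto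
      then show ?thesis using ok[OF S(1,2)] Bx b S(3) sup Cons.prems(2)
        by (auto simp: pvneg)
    next
      case Bx: False
      show ?thesis
      proof (cases "A x")
        case Ax: True
        obtain S where S: "sorted_wrt (<) S" "set S \<subseteq> set ts"
          "path_var p 0 (?P g) + path_var p 0 (?N g) \<le> path_var p 0 (map g S)"
          using Cons.IH[OF srt, of 0 g A B] by auto
        \<comment> \<open>The positive part drops from \<open>a\<close> to \<open>0\<close> at
          \<open>x\<close>. If \<open>S\<close> is empty or its first value \<open>g s\<close> is
          positive, \<open>x\<close> is kept to realise this drop; if \<open>g s \<le> 0\<close>,
          the direct jump from \<open>a\<close> to \<open>g s\<close> already pays for it.\<close>
        have "a powr p + path_var p 0 (map g S) \<le> path_var p a (map g S) \<or>
          a powr p + path_var p 0 (map g S) \<le> \<bar>a - g x\<bar> powr p + path_var p (g x) (map g S)"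
        proof (cases S)
          case Nil
          then show ?thesis using sup by (auto intro: order_trans[rotated])
        next
          case S': (Cons s S')
          show ?thesis
          proof (cases "g s \<le> 0")
            case True
            then show ?thesis
              using S' powr_superadditive[of a "- g s" p] assms(1) Cons.prems(2) by auto
          next
            case False
            have "\<bar>0 - g s\<bar> powr p \<le> \<bar>g x - g s\<bar> powr p"
              using False b assms(1) by (intro powr_mono2) auto
            moreover have "a powr p \<le> \<bar>a - g x\<bar> powr p"
              using sup by (rule order_trans[rotated]) simp
            ultimately show ?thesis using S' by auto
          qed
        qed
        then show ?thesis using ok[OF S(1,2)] Ax Bx b S(3) Cons.prems(2) by auto
      next
        case Ax: False
        obtain S where "sorted_wrt (<) S" "set S \<subseteq> set ts"
          "path_var p a (?P g) + path_var p 0 (?N g) \<le> path_var p a (map g S)"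
          using Cons.IH[OF srt Cons.prems(2)] by blast
        then show ?thesis using ok[of S] Ax Bx by auto
      qed
    qed
  qed
qed

section \<open>Variation bounds\<close>

text \<open>Chains need not contain \<open>0\<close> or \<open>1\<close>, so subchains and tails are
  admissible; \<open>var_p_le_iff\<close> shows agreement with \<open>var_p\<close> for
  \<open>inc f\<close>.\<close>

definition var_bound :: "real \<Rightarrow> (real \<Rightarrow> real \<Rightarrow> real) \<Rightarrow> real \<Rightarrow> bool" where
  "var_bound p d K \<longleftrightarrow>
    (\<forall>t us. sorted_wrt (<) (t # us) \<longrightarrow> set (t # us) \<subseteq> {0..1} \<longrightarrow> inc_sum p d t us \<le> K)"

lemma var_boundD:
  "var_bound p d K \<Longrightarrow> sorted_wrt (<) (t # us) \<Longrightarrow> set (t # us) \<subseteq> {0..1} \<Longrightarrow> inc_sum p d t us \<le> K"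
  unfolding var_bound_def by blast

lemma var_bound_nonneg: "var_bound p d K \<Longrightarrow> 0 \<le> K"
  using var_boundD[of p d K 0 "[]"] by simp

lemma var_bound_weaken: "var_bound p d K \<Longrightarrow> K \<le> L \<Longrightarrow> var_bound p d L"
  unfolding var_bound_def by (meson order_trans)

lemma var_bound_linear:
  assumes "0 \<le> c" "0 \<le> p"
    and dom: "\<And>x y. x \<in> {0..1} \<Longrightarrow> y \<in> {0..1} \<Longrightarrow> 0 \<le> d x y \<and> d x y \<le> c * d' x y"
    and "\<And>x y. 0 \<le> d' x y" "var_bound p d' K"
  shows "var_bound p d (c powr p * K)"
  unfolding var_bound_def
proof (intro allI impI)
  fix t us
  assume srt: "sorted_wrt (<) (t # us)" and sub: "set (t # us) \<subseteq> {0..(1::real)}"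
  have "inc_sum p d t us \<le> c powr p * inc_sum p d' t us"
    using sub
  proof (induction us arbitrary: t)
    case (Cons u us)
    have "d t u powr p \<le> (c * d' t u) powr p"
      using dom[of t u] Cons.prems assms(2) by (intro powr_mono2) auto
    then show ?case using Cons.IH[of u] Cons.prems assms(1,4) by (simp add: powr_mult distrib_left)
  qed simp
  also have "\<dots> \<le> c powr p * K"
    using var_boundD[OF assms(5) srt sub] by (intro mult_left_mono) auto
  finally show "inc_sum p d t us \<le> c powr p * K" .
qed

lemma var_bound_mono:
  assumes "0 \<le> p" "\<And>x y. x \<in> {0..1} \<Longrightarrow> y \<in> {0..1} \<Longrightarrow> 0 \<le> d x y \<and> d x y \<le> d' x y"
    and "\<And>x y. 0 \<le> d' x y" "var_bound p d' K"
  shows "var_bound p d K"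
  using var_bound_linear[of 1 p d d' K] assms by simp

text \<open>Apply \<open>powr_sum_le\<close> term by term. The factor \<open>2 powr p\<close> is
  harmless, since only finiteness and smallness of bounds matter later.\<close>

lemma var_bound_add:
  assumes "0 \<le> p" "\<And>x y. 0 \<le> d x y" "\<And>x y. 0 \<le> d' x y" "var_bound p d K" "var_bound p d' L"
  shows "var_bound p (\<lambda>x y. d x y + d' x y) (2 powr p * (K + L))"
  unfolding var_bound_def
proof (intro allI impI)
  fix t us
  assume srt: "sorted_wrt (<) (t # us)" and sub: "set (t # us) \<subseteq> {0..(1::real)}"
  have "inc_sum p (\<lambda>x y. d x y + d' x y) t us \<le> 2 powr p * (inc_sum p d t us + inc_sum p d' t us)"
  proof (induction us arbitrary: t)
    case (Cons u us)
    show ?case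
      using Cons[of u] powr_sum_le[of "d t u" "d' t u" p] assms(1-3)
      by (simp add: distrib_left)
  qed simp
  also have "\<dots> \<le> 2 powr p * (K + L)"
    using var_boundD[OF assms(4) srt sub] var_boundD[OF assms(5) srt sub]
    by (intro mult_left_mono add_mono) auto
  finally show "inc_sum p (\<lambda>x y. d x y + d' x y) t us \<le> 2 powr p * (K + L)" .
qed

section \<open>Chains versus partitions, and variation bounds versus the norm\<close>

lemma var_part_Cons: "var_p_part p f (t # us) = inc_sum p (inc f) t us"
proof (induction us arbitrary: t)
  case (Cons u us)
  have "var_p_part p f (t # u # us) =
    (\<Sum>j<Suc (length us). norm (f ((t # u # us) ! Suc j) - f ((t # u # us) ! j)) powr p)"
    unfolding var_p_part_def
    by (rule sum.reindex_bij_witness[of _ Suc "\<lambda>j. j - 1"]) auto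
  also have "\<dots> = norm (f t - f u) powr p +
      (\<Sum>j<length us. norm (f ((u # us) ! Suc j) - f ((u # us) ! j)) powr p)"
    by (subst sum.lessThan_Suc_shift) (simp add: norm_minus_commute)
  also have "(\<Sum>j<length us. norm (f ((u # us) ! Suc j) - f ((u # us) ! j)) powr p)
    = var_p_part p f (u # us)"
    unfolding var_p_part_def
    by (rule sum.reindex_bij_witness[of _ "\<lambda>j. j - 1" Suc]) auto
  finally show ?case using Cons.IH[of u] by simp
qed (simp add: var_p_part_def)

text \<open>A chain becomes a partition by adding \<open>0\<close> in front and \<open>1\<close> at
  the end where missing, which only adds nonnegative terms.\<close>

lemma var_p_le_iff: "var_p p f 0 1 \<le> ereal K \<longleftrightarrow> var_bound p (inc f) K"
proof
  assume K: "var_p p f 0 1 \<le> ereal K"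
  have part: "inc_sum p (inc f) 0 us \<le> K" if "is_partition 0 1 (0 # us)" for us
  proof -
    have "ereal (var_p_part p f (0 # us)) \<le> var_p p f 0 1"
      unfolding var_p_def by (rule SUP_upper) (use that in auto)
    then have "ereal (var_p_part p f (0 # us)) \<le> ereal K" using K by (rule order_trans)
    then show ?thesis by (simp add: var_part_Cons)
  qed
  have zero: "inc_sum p (inc f) 0 us \<le> K" if "sorted_wrt (<) (0 # us)" "set us \<subseteq> {0..1}" for us
  proof (cases "1 \<in> set us")
    case True
    then obtain as bs where us: "us = as @ 1 # bs" by (meson split_list)
    have "bs = []" using that us by (cases bs) (auto simp: sorted_wrt_append)
    then show ?thesis using that us by (intro part) (auto simp: is_partition_def)
  next
    case False
    have "inc_sum p (inc f) 0 us \<le> inc_sum p (inc f) 0 (us @ [1])" by (rule inc_sum_append)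
    also have "\<dots> \<le> K"
    proof (rule part)
      have "x < 1" if "x \<in> set us" for x
        using that \<open>set us \<subseteq> {0..1}\<close> False by (auto simp: less_le)
      then show "is_partition 0 1 (0 # us @ [1])"
        using that by (auto simp: is_partition_def sorted_wrt_append)
    qed
    finally show ?thesis .
  qed
  show "var_bound p (inc f) K"
    unfolding var_bound_def
  proof (intro allI impI)
    fix t us
    assume A: "sorted_wrt (<) (t # us)" "set (t # us) \<subseteq> {0..(1::real)}"
    show "inc_sum p (inc f) t us \<le> K"
    proof (cases "t = 0")
      case True
      then show ?thesis using zero[of us] A by auto
    next
      case False
      then have "inc_sum p (inc f) 0 (t # us) \<le> K" using A by (intro zero) force+
      then show ?thesis by (simp add: add_increasing order_trans[rotated])
    qed
  qed
next
  assume vb: "var_bound p (inc f) K"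
  show "var_p p f 0 1 \<le> ereal K"
    unfolding var_p_def
  proof (rule SUP_least)
    fix ts :: "real list"
    assume "ts \<in> {ts. is_partition 0 1 ts}"
    then have ts: "ts \<noteq> []" "sorted_wrt (<) ts" "hd ts = 0" "last ts = 1"
      by (auto simp: is_partition_def)
    then obtain us where us: "ts = 0 # us" by (cases ts) auto
    have "x \<le> 1" if "x \<in> set ts" for x
    proof -
      have "sorted_wrt (<) (butlast ts @ [1])" "x \<in> set (butlast ts @ [1])"
        using ts that append_butlast_last_id[of ts] by auto
      then show ?thesis by (auto simp: sorted_wrt_append)
    qed
    then have "inc_sum p (inc f) 0 us \<le> K"
      using ts us by (intro var_boundD[OF vb]) force+
    then show "ereal (var_p_part p f ts) \<le> ereal K" by (simp add: us var_part_Cons)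
  qed
qed

lemma var_p_nonneg: "0 \<le> var_p p f 0 1"
proof -
  have "0 \<le> ereal (var_p_part p f [0, 1])"
    by (simp add: var_p_part_def sum_nonneg)
  also have "\<dots> \<le> var_p p f 0 1"
    unfolding var_p_def by (rule SUP_upper) (simp add: is_partition_def)
  finally show ?thesis .
qed

lemma BVp_iff:
  "f \<in> BVp p \<longleftrightarrow> (\<forall>x. x \<notin> {0..1} \<longrightarrow> f x = 0) \<and> (\<exists>K. var_bound p (inc f) K)"
proof -
  have "var_p p f 0 1 < \<infinity> \<longleftrightarrow> (\<exists>K. var_p p f 0 1 \<le> ereal K)"
    using var_p_nonneg[of p f] by (cases "var_p p f 0 1") auto
  then show ?thesis by (auto simp: BVp_def var_p_le_iff)
qed

text \<open>The chain from \<open>0\<close> to \<open>x\<close> alone gives this; it makes functions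
  of finite variation bounded.\<close>

lemma var_bound_pointwise:
  assumes "var_bound p (inc f) K" "0 < p" "x \<in> {0..1}"
  shows "norm (f x) \<le> norm (f 0) + K powr (1 / p)"
proof (cases "x = 0")
  case True
  then show ?thesis by simp
next
  case False
  then have "norm (f 0 - f x) powr p \<le> K"
    using var_boundD[OF assms(1), of 0 "[x]"] assms(3) by simp
  then have "(norm (f 0 - f x) powr p) powr (1 / p) \<le> K powr (1 / p)"
    using assms(2) by (intro powr_mono2) auto
  then have "norm (f 0 - f x) \<le> K powr (1 / p)"
    using assms(2) by (simp add: powr_powr)
  then show ?thesis using norm_triangle_ineq3[of "f x" "f 0"]
    by (simp add: norm_minus_commute)
qed

text \<open>Two contributions of \<open>e / 3\<close> leave room for the strict inequality.\<close>

lemma bvp_norm_less: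
  assumes "0 < p" "0 < e" "\<And>x. x \<in> {0..1} \<Longrightarrow> norm (f x) \<le> e / 3"
    and "var_bound p (inc f) ((e / 3) powr p)"
  shows "bvp_norm p f < e"
proof -
  have "sup_norm f \<le> e / 3"
    unfolding sup_norm_def by (rule cSUP_least) (use assms(3) in auto)
  moreover have "real_of_ereal (var_p p f 0 1) \<le> (e / 3) powr p"
    using assms(4) var_p_nonneg[of p f] unfolding var_p_le_iff[symmetric]
    by (cases "var_p p f 0 1") auto
  then have "real_of_ereal (var_p p f 0 1) powr (1 / p) \<le> ((e / 3) powr p) powr (1 / p)"
    using assms(1) var_p_nonneg[of p f] by (intro powr_mono2) (auto simp: real_of_ereal_pos)
  then have "real_of_ereal (var_p p f 0 1) powr (1 / p) \<le> e / 3"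
    using assms(1,2) by (simp add: powr_powr)
  ultimately show ?thesis unfolding bvp_norm_def using assms(2) by linarith
qed

text \<open>The bound \<open>K\<close> certifies finiteness: it makes the supremum a genuine upper
  bound and excludes infinite variation, which \<open>real_of_ereal\<close> would send to
  \<open>0\<close>.\<close>

lemma bvp_norm_lessD:
  assumes "0 < p" "var_bound p (inc f) K" "bvp_norm p f < e"
  shows "\<And>x. x \<in> {0..1} \<Longrightarrow> norm (f x) < e" and "var_bound p (inc f) (e powr p)"
proof -
  have bdd: "bdd_above ((\<lambda>x. norm (f x)) ` {0..1})"
    using var_bound_pointwise[OF assms(2,1)] by (intro bdd_aboveI2)
  define v where "v = real_of_ereal (var_p p f 0 1)"
  have v: "0 \<le> v" "var_p p f 0 1 = ereal v"
    using assms(2) var_p_nonneg[of p f] unfolding var_p_le_iff[symmetric] v_def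
    by (cases "var_p p f 0 1"; simp)+
  have sup: "norm (f x) \<le> sup_norm f" if "x \<in> {0..1}" for x
    unfolding sup_norm_def using bdd that by (rule cSUP_upper2) auto
  have less: "sup_norm f + v powr (1 / p) < e"
    using assms(3) by (simp add: bvp_norm_def v_def)
  show "norm (f x) < e" if "x \<in> {0..1}" for x
    using sup[OF that] less powr_ge_zero[of v "1 / p"] by linarith
  have "0 \<le> sup_norm f" using order_trans[OF norm_ge_zero sup, of 0] by simp
  then have "v powr (1 / p) \<le> e" using less by linarith
  then have "(v powr (1 / p)) powr p \<le> e powr p"
    using assms(1) by (intro powr_mono2) auto
  then have "v \<le> e powr p" using assms(1) v by (simp add: powr_powr)
  then show "var_bound p (inc f) (e powr p)"
    using v by (simp flip: var_p_le_iff)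
qed

section \<open>Truncation at small levels\<close>

text \<open>Turns unrelated chains into filters of one sorted list with common start
  \<open>0\<close>, the form that \<open>path_var_pos_neg_parts\<close> takes. Prepending
  \<open>0\<close> cannot lower the sum.\<close>

lemma inc_sum_le_filter:
  assumes "sorted_wrt (<) (t # us)" "set (t # us) \<subseteq> {0..(1::real)}" "set (t # us) \<subseteq> C" "finite C"
  shows "inc_sum p d t us \<le>
    inc_sum p d 0 (filter (\<lambda>x. x \<in> set (t # us)) (sorted_list_of_set (C - {0})))"
proof -
  let ?Q = "filter (\<lambda>x. x \<in> set (t # us)) (sorted_list_of_set (C - {0}))"
  have Q: "sorted_wrt (<) ?Q" "set ?Q = set (t # us) - {0}"
    using assms(3,4) by (auto intro!: sorted_wrt_filter)
  show ?thesis
  proof (cases "t = 0")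
    case True
    then have "?Q = us"
      using Q assms(1,2) by (intro strict_sorted_equal) auto
    then show ?thesis using True by simp
  next
    case False
    then have "?Q = t # us"
      using Q assms(1,2) by (intro strict_sorted_equal) force+
    then show ?thesis by (simp only:) simp
  qed
qed

text \<open>Up to sign and an additive constant, the two functions are the positive and the negative
  part of \<open>f - r\<close>. The chains are independent, so one can be fixed while the other runs
  over all chains.\<close>

lemma inc_sum_truncation:
  fixes f :: "real \<Rightarrow> real"
  assumes "1 \<le> p" "var_bound p (inc f) K"
    and tu: "sorted_wrt (<) (t # us)" "set (t # us) \<subseteq> {0..1}"
    and tu': "sorted_wrt (<) (t' # us')" "set (t' # us') \<subseteq> {0..1}"
  shows "inc_sum p (inc (\<lambda>x. max (f x - r) 0)) t us + inc_sum p (inc (\<lambda>x. min (f x) r)) t' us' \<le> K"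
proof -
  define C where "C = set (t # us) \<union> set (t' # us')"
  define Q where "Q = sorted_list_of_set (C - {0})"
  let ?P = "filter (\<lambda>x. x \<in> set (t # us)) Q" and ?P' = "filter (\<lambda>x. x \<in> set (t' # us')) Q"
  define g where "g x = f x - r" for x
  have C: "finite C" "C \<subseteq> {0..1}" using tu tu' by (auto simp: C_def)
  have Q: "sorted_wrt (<) Q" "set Q = C - {0}" using C by (auto simp: Q_def)
  have le: "inc_sum p (inc (\<lambda>x. max (g x) 0)) t us \<le> inc_sum p (inc (\<lambda>x. max (g x) 0)) 0 ?P"
    "inc_sum p (inc (\<lambda>x. max (- g x) 0)) t' us' \<le> inc_sum p (inc (\<lambda>x. max (- g x) 0)) 0 ?P'"
    unfolding Q_def using C tu tu' by (intro inc_sum_le_filter; auto simp: C_def)+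
  have eq: "inc (\<lambda>x. min (f x) r) = inc (\<lambda>x. max (- g x) 0)"
    by (intro ext) (auto simp: g_def min_def max_def)
  have neg: "inc_sum p (inc (\<lambda>x. - g x)) s vs = inc_sum p (inc g) s vs" for s vs
    by (simp add: norm_minus_commute abs_minus_commute)
  have bound: "inc_sum p (inc g) 0 S \<le> K" if "sorted_wrt (<) S" "set S \<subseteq> set Q" for S
  proof -
    have "inc_sum p (inc f) 0 S \<le> K"
      using that Q C by (intro var_boundD[OF assms(2)]) force+
    then show ?thesis by (simp add: g_def)
  qed
  have "inc_sum p (inc (\<lambda>x. max (g x) 0)) 0 ?P + inc_sum p (inc (\<lambda>x. max (- g x) 0)) 0 ?P' \<le> K"
  \<comment> \<open>\<open>path_var_pos_neg_parts\<close> needs a nonnegative starting value;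
    otherwise it is applied to \<open>- g\<close>, which exchanges the two parts.\<close>
  proof (cases "0 \<le> g 0")
    case True
    obtain S where "sorted_wrt (<) S" "set S \<subseteq> set Q"
      "path_var p (g 0) (map (\<lambda>x. max (g x) 0) ?P) + path_var p 0 (map (\<lambda>x. max (- g x) 0) ?P')
        \<le> path_var p (g 0) (map g S)"
      using path_var_pos_neg_parts[OF assms(1) Q(1) True] by blast
    then show ?thesis using True bound[of S] unfolding inc_sum_map by simp
  next
    case False
    then have "0 \<le> - g 0" by simp
    obtain S where S: "sorted_wrt (<) S" "set S \<subseteq> set Q"
      "path_var p (- g 0) (map (\<lambda>x. max (- g x) 0) ?P')
        + path_var p 0 (map (\<lambda>x. max (- (- g x)) 0) ?P)
        \<le> path_var p (- g 0) (map (\<lambda>x. - g x) S)"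
      using path_var_pos_neg_parts[OF assms(1) Q(1) \<open>0 \<le> - g 0\<close>, where g = "\<lambda>x. - g x"] by blast
    have "path_var p (- g 0) (map (\<lambda>x. - g x) S) \<le> K"
      using bound[OF S(1,2)] neg[of 0 S] unfolding inc_sum_map by simp
    then show ?thesis using False S(3) unfolding inc_sum_map by simp
  qed
  then show ?thesis using le unfolding eq g_def by linarith
qed

section \<open>Families of increments whose variation tends to zero\<close>

definition var_vanishes :: "real \<Rightarrow> (real \<Rightarrow> real \<Rightarrow> real \<Rightarrow> real) \<Rightarrow> bool" where
  "var_vanishes p d \<longleftrightarrow> (\<forall>e>0. \<exists>r0>0. \<forall>r. 0 < r \<longrightarrow> r < r0 \<longrightarrow> var_bound p (d r) e)"

lemma var_vanishesD:
  assumes "var_vanishes p d" "0 < e"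
  obtains r0 where "0 < r0" "\<And>r. 0 < r \<Longrightarrow> r < r0 \<Longrightarrow> var_bound p (d r) e"
  using assms unfolding var_vanishes_def by blast

lemma var_vanishes_linear:
  assumes "var_vanishes p d'" "0 \<le> c" "0 \<le> p" "\<And>r x y. 0 \<le> d' r x y"
    and "\<And>r x y. 0 < r \<Longrightarrow> x \<in> {0..1} \<Longrightarrow> y \<in> {0..1} \<Longrightarrow> 0 \<le> d r x y \<and> d r x y \<le> c * d' r x y"
  shows "var_vanishes p d"
  unfolding var_vanishes_def
proof (intro allI impI)
  fix e :: real assume "0 < e"
  \<comment> \<open>The summand \<open>1\<close> keeps the denominator positive when
    \<open>c = 0\<close>.\<close>
  define e' where "e' = e / (c powr p + 1)"
  have "0 < c powr p + 1" by (simp add: add_nonneg_pos)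
  then have e': "0 < e'" "c powr p * e' \<le> e"
    using \<open>0 < e\<close> by (auto simp: e'_def field_simps)
  obtain r0 where r0: "0 < r0" "\<And>r. 0 < r \<Longrightarrow> r < r0 \<Longrightarrow> var_bound p (d' r) e'"
    using assms(1) e'(1) by (rule var_vanishesD) blast
  have "var_bound p (d r) e" if "0 < r" "r < r0" for r
    using var_bound_linear[OF assms(2,3) assms(5)[OF that(1)] assms(4) r0(2)[OF that]] e'(2)
    by (rule var_bound_weaken)
  then show "\<exists>r0>0. \<forall>r. 0 < r \<longrightarrow> r < r0 \<longrightarrow> var_bound p (d r) e" using r0(1) by blast
qed

lemma var_vanishes_add:
  assumes "var_vanishes p d" "var_vanishes p d'" "0 \<le> p"
    and "\<And>r x y. 0 \<le> d r x y" "\<And>r x y. 0 \<le> d' r x y"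
  shows "var_vanishes p (\<lambda>r x y. d r x y + d' r x y)"
  unfolding var_vanishes_def
proof (intro allI impI)
  fix e :: real assume "0 < e"
  define e' where "e' = e / (2 powr p * 2)"
  have e': "0 < e'" "2 powr p * (e' + e') = e"
    using \<open>0 < e\<close> by (auto simp: e'_def)
  obtain r0 where r0: "0 < r0" "\<And>r. 0 < r \<Longrightarrow> r < r0 \<Longrightarrow> var_bound p (d r) e'"
    using assms(1) e'(1) by (rule var_vanishesD) blast
  obtain r1 where r1: "0 < r1" "\<And>r. 0 < r \<Longrightarrow> r < r1 \<Longrightarrow> var_bound p (d' r) e'"
    using assms(2) e'(1) by (rule var_vanishesD) blast
  have "var_bound p (\<lambda>x y. d r x y + d' r x y) e" if "0 < r" "r < min r0 r1" for r
    using var_bound_add[OF assms(3) assms(4,5) r0(2) r1(2), of r r] e'(2) that by simp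
  moreover have "0 < min r0 r1" using r0 r1 by simp
  ultimately show "\<exists>r0>0. \<forall>r. 0 < r \<longrightarrow> r < r0 \<longrightarrow> var_bound p (\<lambda>x y. d r x y + d' r x y) e"
    by blast
qed

lemma var_vanishes_sum:
  assumes "finite I" "\<And>i. i \<in> I \<Longrightarrow> var_vanishes p (d i)" "0 \<le> p" "\<And>i r x y. 0 \<le> d i r x y"
  shows "var_vanishes p (\<lambda>r x y. \<Sum>i\<in>I. d i r x y)"
  using assms(1,2)
proof (induction I rule: finite_induct)
  case empty
  have "inc_sum p (\<lambda>x y. 0) t us = 0" for t :: real and us
    by (induction us arbitrary: t) auto
  then show ?case by (auto simp: var_vanishes_def var_bound_def intro: exI[of _ 1])
next
  case (insert i I)
  then show ?case using assms(3,4)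
    by (simp add: var_vanishes_add sum_nonneg)
qed

text \<open>The soft thresholds \<open>max (f - r) 0\<close> exhaust the variation of \<open>f\<close> as \<open>r\<close> tends to \<open>0\<close>, so the
  truncations \<open>min f r\<close> are left with none of it.\<close>

lemma var_vanishes_min:
  fixes f :: "real \<Rightarrow> real"
  assumes "1 \<le> p" "var_bound p (inc f) K" "\<And>x. 0 \<le> f x"
  shows "var_vanishes p (\<lambda>r. inc (\<lambda>x. min (f x) (2 * r)))"
  unfolding var_vanishes_def
proof (intro allI impI)
  fix e :: real assume "0 < e"
  define V where "V = {inc_sum p (inc f) t us | t us. sorted_wrt (<) (t # us) \<and> set (t # us) \<subseteq> {0..1}}"
  have bdd: "bdd_above V"
    using var_boundD[OF assms(2)] by (auto simp: V_def intro!: bdd_aboveI[of _ K])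
  have "inc_sum p (inc f) 0 [] \<in> V"
    unfolding V_def by (intro CollectI exI[of _ 0] exI[of _ "[]"]) auto
  then have "V \<noteq> {}" by blast
  \<comment> \<open>The bound \<open>K\<close> may be far from optimal; a chain within
    \<open>e / 2\<close> of the bound is guaranteed only for the exact variation
    \<open>Sup V\<close>.\<close>
  have vb: "var_bound p (inc f) (Sup V)"
    unfolding var_bound_def
  proof (intro allI impI)
    fix t us assume "sorted_wrt (<) (t # us)" "set (t # us) \<subseteq> {0..(1::real)}"
    then have "inc_sum p (inc f) t us \<in> V" unfolding V_def by blast
    then show "inc_sum p (inc f) t us \<le> Sup V" using bdd by (rule cSup_upper)
  qed
  have "Sup V - e / 2 < Sup V" using \<open>0 < e\<close> by simp
  then obtain v where "v \<in> V" "Sup V - e / 2 < v"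
    using less_cSupD[OF \<open>V \<noteq> {}\<close>] by blast
  then obtain t us where tu: "sorted_wrt (<) (t # us)" "set (t # us) \<subseteq> {0..1}"
    and large: "Sup V - e / 2 < inc_sum p (inc f) t us"
    by (auto simp: V_def)
  \<comment> \<open>On a fixed finite chain every term of the thresholded sum is continuous in
    \<open>r\<close>, so the sum stays above \<open>Sup V - e / 2\<close> for small
    \<open>r\<close>; \<open>inc_sum_truncation\<close> then leaves less than \<open>e / 2\<close>
    to the truncation.\<close>
  have "((\<lambda>r. inc_sum p (inc (\<lambda>x. max (f x - 2 * r) 0)) t us)
      \<longlongrightarrow> inc_sum p (inc (\<lambda>x. max (f x - 2 * 0) 0)) t us) (at_right 0)" for us
  proof (induction us arbitrary: t)
    case (Cons u us)
    show ?case
      unfolding inc_sum.simps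
      using assms(1) by (intro tendsto_add Cons.IH tendsto_powr' tendsto_norm tendsto_diff tendsto_max
          tendsto_mult tendsto_const tendsto_ident_at) auto
  qed simp
  moreover have "inc (\<lambda>x. max (f x - 2 * 0) 0) = inc f"
    using assms(3) by (simp add: max_absorb1)
  ultimately have "((\<lambda>r. inc_sum p (inc (\<lambda>x. max (f x - 2 * r) 0)) t us)
      \<longlongrightarrow> inc_sum p (inc f) t us) (at_right 0)" by simp
  then have "\<forall>\<^sub>F r in at_right 0. Sup V - e / 2 < inc_sum p (inc (\<lambda>x. max (f x - 2 * r) 0)) t us"
    using large by (rule order_tendstoD)
  then obtain r0 where r0: "0 < r0"
    "\<And>r. 0 < r \<Longrightarrow> r < r0 \<Longrightarrow> Sup V - e / 2 < inc_sum p (inc (\<lambda>x. max (f x - 2 * r) 0)) t us"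
    by (auto simp: eventually_at_right_field)
  have "var_bound p (inc (\<lambda>x. min (f x) (2 * r))) e" if r: "0 < r" "r < r0" for r
    unfolding var_bound_def
  proof (intro allI impI)
    fix t' us'
    assume "sorted_wrt (<) (t' # us')" "set (t' # us') \<subseteq> {0..(1::real)}"
    from inc_sum_truncation[OF assms(1) vb tu this, of "2 * r"]
    show "inc_sum p (inc (\<lambda>x. min (f x) (2 * r))) t' us' \<le> e"
      using r0(2)[OF r] \<open>0 < e\<close> by linarith
  qed
  then show "\<exists>r0>0. \<forall>r. 0 < r \<longrightarrow> r < r0 \<longrightarrow> var_bound p (inc (\<lambda>x. min (f x) (2 * r))) e"
    using r0(1) by blast
qed

text \<open>For \<open>0 < r\<close> the clamp of \<open>f\<close> is the difference of the
  truncated positive and negative parts of \<open>f\<close>, to which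
  \<open>var_vanishes_min\<close> applies.\<close>

lemma var_vanishes_clamp:
  fixes f :: "real \<Rightarrow> real"
  assumes "1 \<le> p" "var_bound p (inc f) K"
  shows "var_vanishes p (\<lambda>r. inc (\<lambda>x. max (- (2 * r)) (min (f x) (2 * r))))"
proof -
  have "var_bound p (inc (\<lambda>x. max (f x) 0)) K" "var_bound p (inc (\<lambda>x. max (- f x) 0)) K"
    using assms by (auto intro!: var_bound_mono[OF _ _ _ assms(2)])
  then have "var_vanishes p (\<lambda>r. inc (\<lambda>x. min (max (f x) 0) (2 * r)))"
    "var_vanishes p (\<lambda>r. inc (\<lambda>x. min (max (- f x) 0) (2 * r)))"
    using assms(1) by (intro var_vanishes_min; simp)+
  then have "var_vanishes p (\<lambda>r x y. inc (\<lambda>x. min (max (f x) 0) (2 * r)) x y +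
      inc (\<lambda>x. min (max (- f x) 0) (2 * r)) x y)"
    using assms(1) by (intro var_vanishes_add) auto
  then show ?thesis
    by (rule var_vanishes_linear[of _ _ 1]) (use assms(1) in \<open>auto simp: min_def max_def abs_if\<close>)
qed

section \<open>Reduction to nondegenerate pairs\<close>

text \<open>Hysteresis: a point belongs to the set if \<open>\<phi>\<close> has been below \<open>r\<close> and has not exceeded \<open>2 * r\<close>
  since, so that leaving and re-entering the set costs an oscillation of size \<open>r\<close>.\<close>

definition small_set :: "(real \<Rightarrow> real) \<Rightarrow> real \<Rightarrow> real set" where
  "small_set \<phi> r = {x \<in> {0..1}. \<exists>y\<in>{0..x}. \<phi> y < r \<and> (\<forall>z\<in>{y..x}. \<phi> z \<le> 2 * r)}"

text \<open>Each change of membership between \<open>t\<close> and \<open>u\<close> forces a point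
  of \<open>{t<..u}\<close> where \<open>\<phi>\<close> is below \<open>r\<close> (on entering) or
  at least \<open>2 * r\<close> (on leaving). Along these points
  \<open>min (\<phi> x) (2 * r)\<close> moves by at least \<open>r\<close> each time;
  \<open>a\<close> stands for its last recorded value.\<close>

lemma small_set_changes:
  fixes \<phi> :: "real \<Rightarrow> real"
  assumes "0 \<le> p" "0 < r" "\<And>x. 0 \<le> \<phi> x" "sorted_wrt (<) (t # us)" "set (t # us) \<subseteq> {0..1}"
    and "if t \<in> small_set \<phi> r then a \<le> r else 2 * r \<le> a"
  shows "\<exists>S. sorted_wrt (<) (t # S) \<and> set S \<subseteq> {0..1} \<and>
    inc_sum p (\<lambda>x y. r * inc (indicat_real (small_set \<phi> r)) x y) t us
      \<le> path_var p a (map (\<lambda>x. min (\<phi> x) (2 * r)) S)"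
  using assms(4-6)
proof (induction us arbitrary: t a)
  case Nil
  then show ?case by (intro exI[of _ "[]"]) auto
next
  case (Cons u us)
  let ?B = "small_set \<phi> r"
  have srt: "sorted_wrt (<) (u # us)" "set (u # us) \<subseteq> {0..1}" and tu: "t < u" "t \<in> {0..1}" "u \<in> {0..1}"
    using Cons.prems by auto
  show ?case
  proof (cases "t \<in> ?B \<longleftrightarrow> u \<in> ?B")
    case True
    then obtain S where "sorted_wrt (<) (u # S)" "set S \<subseteq> {0..1}"
      "inc_sum p (\<lambda>x y. r * inc (indicat_real ?B) x y) u us
        \<le> path_var p a (map (\<lambda>x. min (\<phi> x) (2 * r)) S)"
      using Cons.IH[OF srt, of a] Cons.prems(3) by auto
    then show ?thesis using True tu assms(1)
      by (intro exI[of _ S]) (auto simp: indicator_def)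
  next
    case False
    \<comment> \<open>On entering, the witness \<open>y\<close> of \<open>u\<close> must lie beyond
      \<open>t\<close>, or it would put \<open>t\<close> in the set. On leaving,
      \<open>\<phi>\<close> must exceed \<open>2 * r\<close> after \<open>t\<close>, or the witness
      of \<open>t\<close> would also serve \<open>u\<close>.\<close>
    obtain z where z: "z \<in> {t<..u}" "if u \<in> ?B then \<phi> z < r else 2 * r \<le> \<phi> z"
    proof (cases "u \<in> ?B")
      case True
      then obtain y where y: "y \<in> {0..u}" "\<phi> y < r" "\<forall>z\<in>{y..u}. \<phi> z \<le> 2 * r"
        by (auto simp: small_set_def)
      have "t < y"
      proof (rule ccontr)
        assume "\<not> t < y"
        then have "t \<in> ?B" using y tu by (auto simp: small_set_def intro!: bexI[of _ y])
        then show False using False True by simp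
      qed
      then show ?thesis using that[of y] y True by auto
    next
      case u: False
      then have "t \<in> ?B" using False by simp
      then obtain y where y: "y \<in> {0..t}" "\<phi> y < r" "\<forall>z\<in>{y..t}. \<phi> z \<le> 2 * r"
        by (auto simp: small_set_def)
      have "\<exists>z\<in>{t<..u}. 2 * r < \<phi> z"
      proof (rule ccontr)
        assume "\<not> ?thesis"
        then have "\<forall>z\<in>{y..u}. \<phi> z \<le> 2 * r" using y(3) by force
        then have "u \<in> ?B" using y tu by (auto simp: small_set_def intro!: bexI[of _ y])
        then show False using u by simp
      qed
      then show ?thesis using that u by force
    qed
    define b where "b = min (\<phi> z) (2 * r)"
    have b: "if u \<in> ?B then b \<le> r else 2 * r \<le> b"
      using z(2) assms(2) by (auto simp: b_def min_def split: if_splits)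
    obtain S where S: "sorted_wrt (<) (u # S)" "set S \<subseteq> {0..1}"
      "inc_sum p (\<lambda>x y. r * inc (indicat_real ?B) x y) u us
        \<le> path_var p b (map (\<lambda>x. min (\<phi> x) (2 * r)) S)"
      using Cons.IH[OF srt b] by blast
    have "r powr p \<le> \<bar>a - b\<bar> powr p"
      using b False Cons.prems(3) assms(1,2) by (intro powr_mono2) (auto split: if_splits)
    then show ?thesis using S z(1) tu False
      by (intro exI[of _ "z # S"]) (auto simp: indicator_def b_def split: if_splits)
  qed
qed

text \<open>Modifications of size \<open>r\<close> made on the small set thus cost little at its
  boundary. \<open>small_set_changes\<close> reduces this to
  \<open>var_vanishes_min\<close>.\<close>

lemma var_vanishes_small_set:
  fixes \<phi> :: "real \<Rightarrow> real"
  assumes "1 \<le> p" "var_bound p (inc \<phi>) K" "\<And>x. 0 \<le> \<phi> x"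
  shows "var_vanishes p (\<lambda>r x y. r * inc (indicat_real (small_set \<phi> r)) x y)"
  unfolding var_vanishes_def
proof (intro allI impI)
  fix e :: real assume "0 < e"
  obtain r0 where r0: "0 < r0"
    "\<And>r. 0 < r \<Longrightarrow> r < r0 \<Longrightarrow> var_bound p (inc (\<lambda>x. min (\<phi> x) (2 * r))) (e / 2)"
    using var_vanishesD[OF var_vanishes_min[OF assms], of "e / 2"] \<open>0 < e\<close> by (metis half_gt_zero)
  define r1 where "r1 = (e / 2) powr (1 / p) / 2"
  have r1: "0 < r1" using \<open>0 < e\<close> by (simp add: r1_def)
  have small: "(2 * r) powr p \<le> e / 2" if "0 < r" "r < r1" for r
  proof -
    have "(2 * r) powr p \<le> ((e / 2) powr (1 / p)) powr p"
      using that assms(1) by (intro powr_mono2) (auto simp: r1_def)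
    then show ?thesis using \<open>0 < e\<close> assms(1) by (simp add: powr_powr)
  qed
  have "var_bound p (\<lambda>x y. r * inc (indicat_real (small_set \<phi> r)) x y) e"
    if r: "0 < r" "r < min r0 r1" for r
    unfolding var_bound_def
  proof (intro allI impI)
    fix t us
    assume tu: "sorted_wrt (<) (t # us)" "set (t # us) \<subseteq> {0..(1::real)}"
    \<comment> \<open>The value of \<open>min (\<phi> t) (2 * r)\<close> may lie strictly between
      \<open>r\<close> and \<open>2 * r\<close>, so the path starts at a fictitious value; its first
      step costs at most \<open>(2 * r) powr p\<close>, which \<open>r1\<close> keeps within
      \<open>e / 2\<close>.\<close>
    define a where "a = (if t \<in> small_set \<phi> r then r else 2 * r)"
    have a: "if t \<in> small_set \<phi> r then a \<le> r else 2 * r \<le> a" by (simp add: a_def)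
    obtain S where S: "sorted_wrt (<) (t # S)" "set S \<subseteq> {0..1}"
      "inc_sum p (\<lambda>x y. r * inc (indicat_real (small_set \<phi> r)) x y) t us
        \<le> path_var p a (map (\<lambda>x. min (\<phi> x) (2 * r)) S)"
      using small_set_changes[OF _ r(1) assms(3) tu a, of p] assms(1) by auto
    have "path_var p a (map (\<lambda>x. min (\<phi> x) (2 * r)) S) \<le> (2 * r) powr p + e / 2"
    proof (cases S)
      case Nil
      then show ?thesis using \<open>0 < e\<close> by simp
    next
      case (Cons s S')
      have "\<bar>a - min (\<phi> s) (2 * r)\<bar> powr p \<le> (2 * r) powr p"
        using assms(1) assms(3)[of s] r by (intro powr_mono2) (auto simp: a_def min_def)
      moreover have "path_var p (min (\<phi> s) (2 * r)) (map (\<lambda>x. min (\<phi> x) (2 * r)) S') \<le> e / 2"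
        unfolding inc_sum_map[symmetric, of p "\<lambda>x. min (\<phi> x) (2 * r)"]
        using S Cons r by (intro var_boundD[OF r0(2)]) auto
      ultimately show ?thesis using Cons by simp
    qed
    then show "inc_sum p (\<lambda>x y. r * inc (indicat_real (small_set \<phi> r)) x y) t us \<le> e"
      using S(3) small[of r] r by simp
  qed
  then show "\<exists>r0>0. \<forall>r. 0 < r \<longrightarrow> r < r0 \<longrightarrow>
      var_bound p (\<lambda>x y. r * inc (indicat_real (small_set \<phi> r)) x y) e"
    using r0(1) r1 by (intro exI[of _ "min r0 r1"]) auto
qed

text \<open>Increments of \<open>F' - F\<close> and \<open>G' - G\<close> fall into three cases:
  inside the small set they are governed by the clamped \<open>F\<close> and \<open>G\<close>,
  across its boundary they are of order \<open>r\<close> and charged to the indicator, and outside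
  they vanish.\<close>

lemma nondegenerate_factorization:
  fixes F G :: "real \<Rightarrow> 'a::{euclidean_space, real_normed_field}"
  assumes p: "1 \<le> p" and F: "var_bound p (inc F) K" and G: "var_bound p (inc G) L" and e: "0 < e"
  obtains F' G' c where "0 < c" "\<And>x. F' x * G' x = F x * G x"
    "\<And>x. x \<in> {0..1} \<Longrightarrow> c \<le> norm (F' x) + norm (G' x)"
    "\<And>x. x \<notin> {0..1} \<Longrightarrow> F' x = F x" "\<And>x. x \<notin> {0..1} \<Longrightarrow> G' x = G x"
    "\<And>x. norm (F' x - F x) \<le> e" "\<And>x. norm (G' x - G x) \<le> e"
    "var_bound p (inc (\<lambda>x. F' x - F x)) e" "var_bound p (inc (\<lambda>x. G' x - G x)) e"
proof -
  define \<phi> where "\<phi> x = norm (F x) + norm (G x)" for x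
  have \<phi>_nonneg: "0 \<le> \<phi> x" for x by (simp add: \<phi>_def)
  have \<phi>: "var_bound p (inc \<phi>) (2 powr p * (K + L))"
  proof (rule var_bound_mono)
    show "var_bound p (\<lambda>x y. inc F x y + inc G x y) (2 powr p * (K + L))"
      using p F G by (intro var_bound_add) auto
    show "0 \<le> inc \<phi> x y \<and> inc \<phi> x y \<le> inc F x y + inc G x y" for x y
      using norm_triangle_ineq3[of "F x" "F y"] norm_triangle_ineq3[of "G x" "G y"]
      by (simp add: \<phi>_def)
  qed (use p in auto)
  let ?B = "small_set \<phi>"
  \<comment> \<open>Truncation has been treated for real functions, so the coordinates are clamped
    one by one; where \<open>norm (H x) \<le> 2 * r\<close> the clamp is inactive, and
    \<open>d H r\<close> dominates \<open>inc H\<close> by the l1 bound.\<close>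
  define d where "d H r x y =
    (\<Sum>b\<in>Basis. inc (\<lambda>x. max (- (2 * r)) (min (H x \<bullet> b) (2 * r))) x y)"
    for H :: "real \<Rightarrow> 'a" and r x y :: real
  have d_nonneg: "0 \<le> d H r x y" for H r x y by (simp add: d_def sum_nonneg)
  have d_vanishes: "var_vanishes p (d H)" if "var_bound p (inc H) M" for H M
    unfolding d_def
  proof (rule var_vanishes_sum)
    fix b :: 'a assume b: "b \<in> Basis"
    have "var_bound p (inc (\<lambda>x. H x \<bullet> b)) M"
      using p b by (intro var_bound_mono[OF _ _ _ that])
        (auto simp: Basis_le_norm simp flip: inner_diff_left)
    then show "var_vanishes p (\<lambda>r. inc (\<lambda>x. max (- (2 * r)) (min (H x \<bullet> b) (2 * r))))"
      by (rule var_vanishes_clamp[OF p])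
  qed (use p in auto)
  have d_ge: "inc H x y \<le> d H r x y" if "norm (H x) \<le> 2 * r" "norm (H y) \<le> 2 * r" for H r x y
  proof -
    have clamp: "max (- (2 * r)) (min (H z \<bullet> b) (2 * r)) = H z \<bullet> b"
      if "b \<in> Basis" "norm (H z) \<le> 2 * r" for b z
      using Basis_le_norm[OF that(1), of "H z"] that(2) by (simp add: abs_le_iff)
    have "inc H x y \<le> (\<Sum>b\<in>Basis. \<bar>(H x - H y) \<bullet> b\<bar>)" by (rule norm_le_l1)
    also have "\<dots> = d H r x y"
      unfolding d_def using that by (intro sum.cong) (auto simp: clamp inner_diff_left)
    finally show ?thesis .
  qed
  define D where "D r x y = d F r x y + d G r x y + r * inc (indicat_real (?B r)) x y" for r x y
  \<comment> \<open>\<open>var_vanishes_add\<close> asks for nonnegative increments at every real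
    \<open>r\<close>, hence \<open>\<bar>r\<bar>\<close>; only \<open>0 < r\<close> counts in
    \<open>var_vanishes\<close>.\<close>
  have "var_vanishes p (\<lambda>r x y. d F \<bar>r\<bar> x y + d G \<bar>r\<bar> x y + \<bar>r\<bar> * inc (indicat_real (?B r)) x y)"
  proof (intro var_vanishes_add)
    show "var_vanishes p (\<lambda>r. d F \<bar>r\<bar>)" "var_vanishes p (\<lambda>r. d G \<bar>r\<bar>)"
      using d_vanishes[OF F] d_vanishes[OF G] by (simp_all add: var_vanishes_def)
    show "var_vanishes p (\<lambda>r x y. \<bar>r\<bar> * inc (indicat_real (?B r)) x y)"
      using var_vanishes_small_set[OF p \<phi> \<phi>_nonneg] by (simp add: var_vanishes_def)
  qed (use p d_nonneg in auto)
  then have "var_vanishes p (\<lambda>r x y. 6 * D r x y)"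
    by (rule var_vanishes_linear[of _ _ 6])
      (use p d_nonneg in \<open>auto simp: D_def intro!: add_nonneg_nonneg\<close>)
  then obtain r0 where r0: "0 < r0" "\<And>r. 0 < r \<Longrightarrow> r < r0 \<Longrightarrow> var_bound p (\<lambda>x y. 6 * D r x y) e"
    using e by (rule var_vanishesD) blast
  \<comment> \<open>Small variation needs \<open>r < r0\<close>, small sup norm needs
    \<open>6 * r \<le> e\<close>: on the small set \<open>G'\<close> has norm at most
    \<open>4 * r\<close> and \<open>G\<close> at most \<open>2 * r\<close>.\<close>
  define r where "r = min (r0 / 2) (e / 6)"
  have r: "0 < r" "r < r0" "6 * r \<le> e" using r0 e by (auto simp: r_def min_def)
  define F' where "F' x = (if x \<in> ?B r then of_real r else F x)" for x
  define G' where "G' x = (if x \<in> ?B r then F x * G x / of_real r else G x)" for x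
  have B: "norm (F x) \<le> 2 * r" "norm (G x) \<le> 2 * r" "x \<in> {0..1}" if "x \<in> ?B r" for x
  proof -
    have "\<phi> x \<le> 2 * r" "x \<in> {0..1}" using that by (auto simp: small_set_def)
    then show "norm (F x) \<le> 2 * r" "norm (G x) \<le> 2 * r" "x \<in> {0..1}"
      using norm_ge_zero[of "F x"] norm_ge_zero[of "G x"] unfolding \<phi>_def by linarith+
  qed
  have FG: "norm (F x * G x / of_real r) \<le> 4 * r" if "x \<in> ?B r" for x
  proof -
    have "norm (F x) * norm (G x) \<le> (2 * r) * (2 * r)"
      using B[OF that] r by (intro mult_mono) auto
    then show ?thesis using r by (simp add: norm_mult norm_divide field_simps)
  qed
  have nF: "norm (F' x - F x) \<le> (if x \<in> ?B r then 3 * r else 0)" for x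
    using B(1)[of x] norm_triangle_ineq4[of "of_real r" "F x"] r by (auto simp: F'_def)
  have nG: "norm (G' x - G x) \<le> (if x \<in> ?B r then 6 * r else 0)" for x
    using B(2)[of x] FG[of x] norm_triangle_ineq4[of "F x * G x / of_real r" "G x"]
    by (auto simp: G'_def)
  have D0: "0 \<le> D r x y" for x y using r d_nonneg by (simp add: D_def)
  have both: "norm ((F' x - F x) - (F' y - F y)) \<le> 6 * D r x y"
    "norm ((G' x - G x) - (G' y - G y)) \<le> 6 * D r x y" for x y
  proof -
    consider "x \<in> ?B r" "y \<in> ?B r" | "x \<in> ?B r \<longleftrightarrow> y \<notin> ?B r" | "x \<notin> ?B r" "y \<notin> ?B r" by blast
    then have "norm ((F' x - F x) - (F' y - F y)) \<le> 6 * D r x y \<and>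
      norm ((G' x - G x) - (G' y - G y)) \<le> 6 * D r x y"
    proof cases
      case 1
      have dF: "inc F x y \<le> d F r x y" and dG: "inc G x y \<le> d G r x y"
        using B 1 by (auto intro!: d_ge)
      \<comment> \<open>The product rule yields a factor \<open>2 * r\<close>, which absorbs the
        division by \<open>r\<close> in \<open>G'\<close>.\<close>
      have "F x * G x - F y * G y = F x * (G x - G y) + (F x - F y) * G y"
        by (simp add: algebra_simps)
      then have "norm (F x * G x - F y * G y) \<le> norm (F x) * inc G x y + inc F x y * norm (G y)"
        by (metis norm_mult norm_triangle_ineq)
      also have "\<dots> \<le> 2 * r * inc G x y + inc F x y * (2 * r)"
        using B 1 by (intro add_mono mult_left_mono mult_right_mono) auto
      finally have "norm (F x * G x - F y * G y) / r \<le> 2 * inc G x y + 2 * inc F x y"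
        using r by (simp add: field_simps)
      moreover have "norm ((G' x - G x) - (G' y - G y)) \<le>
          norm (F x * G x - F y * G y) / r + inc G x y"
      proof -
        have "(G' x - G x) - (G' y - G y) = (F x * G x - F y * G y) / of_real r - (G x - G y)"
          using 1 by (simp add: G'_def diff_divide_distrib)
        then have "norm ((G' x - G x) - (G' y - G y))
            \<le> norm ((F x * G x - F y * G y) / of_real r) + inc G x y"
          by (metis norm_triangle_ineq4)
        then show ?thesis using r by (simp add: norm_divide)
      qed
      moreover have "norm ((F' x - F x) - (F' y - F y)) = inc F x y"
        using 1 by (simp add: F'_def norm_minus_commute)
      moreover have "D r x y = d F r x y + d G r x y" using 1 by (simp add: D_def)
      ultimately show ?thesis
        using dF dG norm_ge_zero[of "F x - F y"] norm_ge_zero[of "G x - G y"] by linarith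
    next
      case 2
      \<comment> \<open>Exactly one of the two points is in the set, so one of the two differences
        is zero and the other is at most \<open>6 * r\<close>.\<close>
      then have "r \<le> D r x y"
        using d_nonneg[of F r x y] d_nonneg[of G r x y] by (auto simp: D_def indicator_def)
      moreover have "norm ((F' x - F x) - (F' y - F y)) \<le> 6 * r"
        "norm ((G' x - G x) - (G' y - G y)) \<le> 6 * r"
        using 2 nF[of x] nF[of y] nG[of x] nG[of y] r
          norm_triangle_ineq4[of "F' x - F x" "F' y - F y"]
          norm_triangle_ineq4[of "G' x - G x" "G' y - G y"] by (auto split: if_splits)
      ultimately show ?thesis by linarith
    next
      case 3
      then show ?thesis using D0[of x y] by (simp add: F'_def G'_def)
    qed
    then show "norm ((F' x - F x) - (F' y - F y)) \<le> 6 * D r x y"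
      "norm ((G' x - G x) - (G' y - G y)) \<le> 6 * D r x y" by auto
  qed
  show thesis
  proof (rule that[of r F' G'])
    show "F' x * G' x = F x * G x" for x using r by (simp add: F'_def G'_def)
    show "r \<le> norm (F' x) + norm (G' x)" if "x \<in> {0..1}" for x
    proof (cases "x \<in> ?B r")
      case True
      then show ?thesis using r by (simp add: F'_def)
    next
      case False
      \<comment> \<open>Otherwise \<open>y = x\<close> would witness that \<open>x\<close> is in the
        small set.\<close>
      then have "\<not> \<phi> x < r" using that r by (force simp: small_set_def)
      then show ?thesis using False by (simp add: F'_def G'_def \<phi>_def)
    qed
    show "F' x = F x" "G' x = G x" if "x \<notin> {0..1}" for x
      using B(3)[of x] that by (auto simp: F'_def G'_def)
    show "norm (F' x - F x) \<le> e" "norm (G' x - G x) \<le> e" for x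
      using nF[of x] nG[of x] r by (auto split: if_splits)
    show "var_bound p (inc (\<lambda>x. F' x - F x)) e" "var_bound p (inc (\<lambda>x. G' x - G x)) e"
      using p D0 both r0(2)[OF r(1,2)] by (auto intro!: var_bound_mono[OF _ _ _ r0(2)[OF r(1,2)]])
  qed (use r in auto)
qed

section \<open>Openness at nondegenerate pairs\<close>

text \<open>The map sending \<open>t\<close> to \<open>(h - t\<^sup>2 * E) / D\<close> contracts the
  ball of radius \<open>2 * \<delta> / m\<close> by the factor \<open>1 / 2\<close>. No branch of a
  square root is chosen, so real and complex scalars are treated alike.\<close>

lemma small_quadratic_root:
  fixes D E h :: "'a::{euclidean_space, real_normed_field}"
  assumes "0 < m" "m \<le> norm D" "norm E \<le> Q" "norm h \<le> \<delta>" "8 * \<delta> * Q \<le> m\<^sup>2"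
  obtains t where "norm t \<le> 2 * \<delta> / m" "t * D + t\<^sup>2 * E = h"
proof -
  define \<tau> where "\<tau> = 2 * \<delta> / m"
  have \<delta>: "0 \<le> \<delta>" "0 \<le> Q" using assms(3,4) norm_ge_zero order_trans by blast+
  then have \<tau>: "0 \<le> \<tau>" "\<delta> = m * \<tau> / 2" using assms(1) by (auto simp: \<tau>_def)
  have \<tau>Q: "4 * (\<tau> * Q) \<le> m"
    using assms(1,5) unfolding \<tau>(2) power2_eq_square by (simp add: mult.assoc)
  have D: "D \<noteq> 0" using assms(1,2) by auto
  let ?f = "\<lambda>t. (h - t\<^sup>2 * E) / D"
  have "\<exists>!t\<in>cball 0 \<tau>. ?f t = t"
  proof (rule Banach_fix[where c = "1 / 2"])
    show "?f ` cball 0 \<tau> \<subseteq> cball 0 \<tau>"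
    proof (intro image_subsetI)
      fix t :: 'a assume "t \<in> cball 0 \<tau>"
      then have t: "norm t \<le> \<tau>" by simp
      have "norm (h - t\<^sup>2 * E) \<le> norm h + norm (t\<^sup>2 * E)" by (rule norm_triangle_ineq4)
      also have "\<dots> \<le> \<delta> + \<tau>\<^sup>2 * Q"
        unfolding norm_mult norm_power using t assms(3,4) \<tau> \<delta>
        by (intro add_mono mult_mono power_mono) auto
      also have "\<dots> \<le> \<tau> * m"
        using mult_left_mono[OF \<tau>Q \<tau>(1)] mult_nonneg_nonneg[OF \<tau>(1), of m] assms(1)
        unfolding \<tau>(2) power2_eq_square by (simp add: algebra_simps)
      also have "\<dots> \<le> \<tau> * norm D" using assms(2) \<tau> by (intro mult_left_mono) auto
      finally show "?f t \<in> cball 0 \<tau>" using D by (simp add: norm_divide field_simps)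
    qed
    show "dist (?f s) (?f t) \<le> 1 / 2 * dist s t" if "s \<in> cball 0 \<tau>" "t \<in> cball 0 \<tau>" for s t
    proof -
      have "(s + t) * E * (t - s) = (h - s\<^sup>2 * E) - (h - t\<^sup>2 * E)"
        by (simp add: power2_eq_square algebra_simps)
      then have "norm ((h - s\<^sup>2 * E) - (h - t\<^sup>2 * E)) = norm (s + t) * norm E * norm (s - t)"
        by (metis norm_mult norm_minus_commute)
      also have "\<dots> \<le> (2 * \<tau>) * Q * norm (s - t)"
        using that assms(3) \<tau> \<delta> norm_triangle_ineq[of s t]
        by (intro mult_right_mono mult_mono) auto
      also have "\<dots> \<le> m / 2 * norm (s - t)"
        using \<tau>Q by (intro mult_right_mono) auto
      also have "\<dots> \<le> norm D / 2 * norm (s - t)"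
        using assms(2) by (intro mult_right_mono) auto
      finally have "norm ((h - s\<^sup>2 * E) - (h - t\<^sup>2 * E)) \<le> norm D / 2 * norm (s - t)" .
      moreover have "?f s - ?f t = ((h - s\<^sup>2 * E) - (h - t\<^sup>2 * E)) / D"
        by (rule diff_divide_distrib[symmetric])
      ultimately show ?thesis using D unfolding dist_norm
        by (simp only: norm_divide) (simp add: field_simps)
    qed
  qed (use \<tau> in \<open>auto intro: compact_imp_complete\<close>)
  then obtain t where "norm t \<le> \<tau>" "?f t = t" by auto
  then show thesis using that[of t] D by (auto simp: \<tau>_def field_simps)
qed

text \<open>Subtracting the equations gives \<open>(t - t') * (D + (t + t') * E) = (h - h') - t' *
  (D - D') - t'\<^sup>2 * (E - E')\<close>, and the second factor has norm at least
  \<open>m / 2\<close>. Small roots therefore depend on the data in a Lipschitz way, however they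
  were chosen.\<close>

lemma quadratic_root_increment:
  fixes t t' D D' E E' h h' :: "'a::real_normed_field"
  assumes "0 < m" "m \<le> norm D" "norm E \<le> Q" "norm t \<le> \<tau>" "norm t' \<le> \<tau>" "4 * (\<tau> * Q) \<le> m" "\<tau> \<le> 1"
    and "t * D + t\<^sup>2 * E = h" "t' * D' + t'\<^sup>2 * E' = h'"
  shows "norm (t - t') \<le> 2 / m * (norm (h - h') + \<tau> * (norm (D - D') + norm (E - E')))"
proof -
  have \<tau>: "0 \<le> \<tau>" using assms(4) norm_ge_zero order_trans by blast
  have "norm ((t + t') * E) \<le> (2 * \<tau>) * Q"
    unfolding norm_mult using assms(3-5) \<tau> norm_triangle_ineq[of t t']
    by (intro mult_mono) auto
  then have "m / 2 \<le> norm (D + (t + t') * E)"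
    using norm_triangle_ineq4[of "D + (t + t') * E" "(t + t') * E"] assms(2,6) by simp
  then have "norm (t - t') * (m / 2) \<le> norm (t - t') * norm (D + (t + t') * E)"
    by (intro mult_left_mono) auto
  also have "\<dots> = norm ((h - h') - t' * (D - D') - t'\<^sup>2 * (E - E'))"
    unfolding norm_mult[symmetric] assms(8,9)[symmetric]
    by (simp add: power2_eq_square algebra_simps)
  also have "\<dots> \<le> norm (h - h') + norm (t' * (D - D')) + norm (t'\<^sup>2 * (E - E'))"
    by (rule order_trans[OF norm_triangle_ineq4 add_right_mono[OF norm_triangle_ineq4]])
  also have "\<dots> \<le> norm (h - h') + \<tau> * norm (D - D') + \<tau> * norm (E - E')"
  proof -
    have "(norm t')\<^sup>2 \<le> \<tau> * 1"
      unfolding power2_eq_square using assms(5,7) \<tau> by (intro mult_mono) auto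
    then show ?thesis unfolding norm_mult norm_power using assms(5)
      by (intro add_mono mult_right_mono) auto
  qed
  finally show ?thesis using assms(1) by (simp add: field_simps)
qed

lemma norm_mult_diff_le:
  fixes a b a' b' :: "'a::real_normed_algebra"
  shows "norm (a * b - a' * b') \<le> norm (a - a') * norm b + norm a' * norm (b - b')"
proof -
  have "a * b - a' * b' = (a - a') * b + a' * (b - b')" by (simp add: algebra_simps)
  then have "norm (a * b - a' * b') \<le> norm ((a - a') * b) + norm (a' * (b - b'))"
    by (simp only: norm_triangle_ineq)
  also have "\<dots> \<le> norm (a - a') * norm b + norm a' * norm (b - b')"
    by (intro add_mono norm_mult_ineq)
  finally show ?thesis .
qed

text \<open>The abstract conjugation \<open>k\<close> covers both the identity of the reals and
  \<open>cnj\<close>. The variation of \<open>F\<close> and \<open>G\<close> enters the estimates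
  only with a factor of order \<open>\<delta>\<close>, which is why one \<open>\<delta>\<close>
  serves all \<open>h\<close>.\<close>

lemma nondegenerate_perturbation:
  fixes F G :: "real \<Rightarrow> 'a::{euclidean_space, real_normed_field}" and k :: "'a \<Rightarrow> 'a"
  assumes k: "\<And>z. norm (k z) = norm z" "\<And>z w. k (z - w) = k z - k w"
    "\<And>z. z * k z = of_real ((norm z)\<^sup>2)"
    and p: "1 \<le> p" and F: "var_bound p (inc F) K" and G: "var_bound p (inc G) L"
    and M: "\<And>x. x \<in> {0..1} \<Longrightarrow> norm (F x) \<le> M" "\<And>x. x \<in> {0..1} \<Longrightarrow> norm (G x) \<le> M"
    and c: "0 < c" "\<And>x. x \<in> {0..1} \<Longrightarrow> c \<le> norm (F x) + norm (G x)" and e: "0 < e"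
  obtains \<delta> where "0 < \<delta>" "\<And>h. (\<And>x. x \<in> {0..1} \<Longrightarrow> norm (h x) \<le> \<delta>) \<Longrightarrow>
    var_bound p (inc h) (\<delta> powr p) \<Longrightarrow>
    \<exists>a b. (\<forall>x\<in>{0..1}. (F x + a x) * (G x + b x) = F x * G x + h x) \<and>
      (\<forall>x. norm (a x) \<le> e \<and> norm (b x) \<le> e) \<and> (\<forall>x. x \<notin> {0..1} \<longrightarrow> a x = 0 \<and> b x = 0) \<and>
      var_bound p (inc a) e \<and> var_bound p (inc b) e"
proof -
  \<comment> \<open>\<open>m\<close> bounds \<open>D\<close> from below, as the square of a sum is
    at most twice the sum of squares. \<open>C\<close> compares the increments of the perturbations
    with \<open>inc h x y + \<delta> * S x y\<close>, whose variation is at most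
    \<open>\<delta> powr p * W\<close>.\<close>
  define m where "m = c\<^sup>2 / 2"
  define C where "C = 2 * M / m + 12 * M\<^sup>2 / m\<^sup>2 + 2 / m"
  define W where "W = 2 powr p * (1 + 2 powr p * (K + L))"
  have M0: "0 < M" using c(1) c(2)[of 0] M[of 0] by auto
  have m: "0 < m" using c(1) by (simp add: m_def)
  have C: "0 < C" using M0 m by (auto simp: C_def intro!: add_pos_pos)
  have W: "0 < W" using var_bound_nonneg[OF F] var_bound_nonneg[OF G]
    unfolding W_def by (intro mult_pos_pos add_pos_nonneg) auto
  \<comment> \<open>The four terms ensure, in order: solvability of the quadratic equation,
    \<open>\<tau> \<le> 1\<close>, perturbations of norm at most \<open>e\<close>, and of variation
    at most \<open>e\<close>.\<close>
  define \<delta> where "\<delta> = min (min (m\<^sup>2 / (8 * M\<^sup>2)) (m / 2))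
    (min (e * m / (2 * M)) ((e / (C powr p * W)) powr (1 / p)))"
  have \<delta>: "0 < \<delta>" using m M0 e C W by (simp add: \<delta>_def)
  have "\<delta> \<le> m\<^sup>2 / (8 * M\<^sup>2)" "\<delta> \<le> m / 2" "\<delta> \<le> e * m / (2 * M)" by (auto simp: \<delta>_def)
  then have \<delta>le: "8 * \<delta> * M\<^sup>2 \<le> m\<^sup>2" "2 * \<delta> / m \<le> 1" "2 * \<delta> / m * M \<le> e"
    using m M0 by (auto simp: field_simps)
  have "\<delta> powr p \<le> ((e / (C powr p * W)) powr (1 / p)) powr p"
    using \<delta> p by (intro powr_mono2) (auto simp: \<delta>_def)
  then have \<delta>p: "C powr p * (\<delta> powr p * W) \<le> e"
    using p e C W by (simp add: powr_powr field_simps)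
  define \<tau> where "\<tau> = 2 * \<delta> / m"
  have \<tau>: "0 \<le> \<tau>" "\<tau> \<le> 1" "\<tau> * M \<le> e" "4 * (\<tau> * M\<^sup>2) \<le> m"
    using \<delta> \<delta>le m by (auto simp: \<tau>_def field_simps power2_eq_square)
  define D where "D x = F x * k (F x) + G x * k (G x)" for x
  define E where "E x = k (F x) * k (G x)" for x
  have D_eq: "D x = of_real ((norm (F x))\<^sup>2 + (norm (G x))\<^sup>2)" for x by (simp add: D_def k(3))
  have D: "m \<le> norm (D x)" if "x \<in> {0..1}" for x
  proof -
    have "c\<^sup>2 \<le> (norm (F x) + norm (G x))\<^sup>2" using c that by (intro power_mono) auto
    also have "\<dots> \<le> 2 * ((norm (F x))\<^sup>2 + (norm (G x))\<^sup>2)"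
      using sum_squares_bound[of "norm (F x)" "norm (G x)"] by (simp add: power2_sum)
    finally show ?thesis unfolding D_eq m_def norm_of_real by simp
  qed
  have E: "norm (E x) \<le> M\<^sup>2" if "x \<in> {0..1}" for x
    unfolding E_def norm_mult k(1) power2_eq_square using M that M0 by (intro mult_mono) auto
  define S where "S x y = inc F x y + inc G x y" for x y
  have prod: "norm (f x * g x - f y * g y) \<le> M * (norm (f x - f y) + norm (g x - g y))"
    if "norm (g x) \<le> M" "norm (f y) \<le> M" for f g :: "real \<Rightarrow> 'a" and x y
  proof -
    have "norm (f x * g x - f y * g y) \<le> norm (f x - f y) * norm (g x) + norm (f y) * norm (g x - g y)"
      by (rule norm_mult_diff_le)
    also have "\<dots> \<le> norm (f x - f y) * M + M * norm (g x - g y)"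
      using that by (intro add_mono mult_left_mono mult_right_mono) auto
    finally show ?thesis by (simp add: algebra_simps)
  qed
  have DE: "inc D x y + inc E x y \<le> 3 * M * S x y" if "x \<in> {0..1}" "y \<in> {0..1}" for x y
  proof -
    have kd: "norm (k u - k v) = norm (u - v)" for u v by (simp add: k(1) flip: k(2))
    have "inc D x y \<le> norm (F x * k (F x) - F y * k (F y)) + norm (G x * k (G x) - G y * k (G y))"
      unfolding D_def by (metis add_diff_add norm_triangle_ineq)
    also have "\<dots> \<le> M * (inc F x y + inc F x y) + M * (inc G x y + inc G x y)"
      using M that prod[of "\<lambda>x. k (F x)" x F y] prod[of "\<lambda>x. k (G x)" x G y]
      by (intro add_mono) (simp_all add: k(1) kd)
    finally have "inc D x y \<le> 2 * M * S x y" by (simp add: S_def algebra_simps)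
    moreover have "inc E x y \<le> M * S x y"
      using M that prod[of "\<lambda>x. k (G x)" x "\<lambda>x. k (F x)" y] by (simp add: k(1) kd E_def S_def)
    ultimately show ?thesis by (simp add: algebra_simps)
  qed
  show thesis
  proof (rule that[OF \<delta>])
    fix h :: "real \<Rightarrow> 'a"
    assume h: "\<And>x. x \<in> {0..1} \<Longrightarrow> norm (h x) \<le> \<delta>" "var_bound p (inc h) (\<delta> powr p)"
    \<comment> \<open>The roots are picked independently at each point;
      \<open>quadratic_root_increment\<close> controls their variation afterwards.\<close>
    have "\<exists>t. \<forall>x\<in>{0..1}. norm (t x) \<le> \<tau> \<and> t x * D x + (t x)\<^sup>2 * E x = h x"
    proof (rule bchoice, rule ballI)
      fix x :: real assume x: "x \<in> {0..1}"
      show "\<exists>t. norm t \<le> \<tau> \<and> t * D x + t\<^sup>2 * E x = h x"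
        using small_quadratic_root[OF m D[OF x] E[OF x] h(1)[OF x] \<delta>le(1)] unfolding \<tau>_def by metis
    qed
    then obtain t where t: "\<And>x. x \<in> {0..1} \<Longrightarrow> norm (t x) \<le> \<tau>"
      "\<And>x. x \<in> {0..1} \<Longrightarrow> t x * D x + (t x)\<^sup>2 * E x = h x" by blast
    define R where "R x y = inc h x y + \<delta> * S x y" for x y
    have R0: "0 \<le> R x y" for x y using \<delta> by (simp add: R_def S_def)
    have vbS: "var_bound p S (2 powr p * (K + L))"
      unfolding S_def using p F G by (intro var_bound_add) auto
    have vbR: "var_bound p R (\<delta> powr p * W)"
    proof -
      have "var_bound p (\<lambda>x y. \<delta> * S x y) (\<delta> powr p * (2 powr p * (K + L)))"
        using \<delta> p by (intro var_bound_linear[OF _ _ _ _ vbS]) (auto simp: S_def)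
      then have "var_bound p R (2 powr p * (\<delta> powr p + \<delta> powr p * (2 powr p * (K + L))))"
        unfolding R_def using p h(2) \<delta> by (intro var_bound_add) (auto simp: S_def)
      then show ?thesis by (simp add: W_def algebra_simps)
    qed
    have dt: "inc t x y \<le> 2 / m * (inc h x y + \<tau> * (3 * M * S x y))"
      if "x \<in> {0..1}" "y \<in> {0..1}" for x y
    proof -
      have "inc t x y \<le> 2 / m * (inc h x y + \<tau> * (inc D x y + inc E x y))"
        using quadratic_root_increment[OF m D E t(1) t(1) \<tau>(4) \<tau>(2) t(2) t(2)] that by simp
      also have "\<dots> \<le> 2 / m * (inc h x y + \<tau> * (3 * M * S x y))"
        using DE[OF that] \<tau> m by (intro mult_left_mono add_left_mono) auto
      finally show ?thesis .
    qed
    define w where "w H x = (if x \<in> {0..1} then t x * k (H x) else 0)" for H :: "real \<Rightarrow> 'a" and x :: real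
    have w_norm: "norm (w H x) \<le> e" if "\<And>x. x \<in> {0..1} \<Longrightarrow> norm (H x) \<le> M" for H x
    proof (cases "x \<in> {0..1}")
      case True
      then have "norm (w H x) \<le> \<tau> * M"
        unfolding w_def using that t(1) \<tau> by (auto simp: norm_mult k(1) intro!: mult_mono)
      then show ?thesis using \<tau>(3) by simp
    qed (use e in \<open>auto simp: w_def\<close>)
    have w_vb: "var_bound p (inc (w H)) e"
      if H: "\<And>x. x \<in> {0..1} \<Longrightarrow> norm (H x) \<le> M" "\<And>x y. inc H x y \<le> S x y" for H
    proof -
      have "inc (w H) x y \<le> C * R x y" if xy: "x \<in> {0..1}" "y \<in> {0..1}" for x y
      proof -
        have "inc (w H) x y \<le> inc t x y * norm (k (H x)) + norm (t y) * norm (k (H x) - k (H y))"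
          using xy norm_mult_diff_le[of "t x" "k (H x)" "t y" "k (H y)"] by (simp add: w_def)
        also have "\<dots> \<le> 2 / m * (inc h x y + \<tau> * (3 * M * S x y)) * M + \<tau> * S x y"
          unfolding k(2)[symmetric] k(1)
          using H xy dt[OF xy] t(1) \<tau> m M0
          by (intro add_mono mult_mono) (auto simp: S_def intro!: mult_nonneg_nonneg add_nonneg_nonneg)
        also have "\<dots> = 2 * M / m * inc h x y + (12 * M\<^sup>2 / m\<^sup>2 + 2 / m) * (\<delta> * S x y)"
          using m by (simp add: \<tau>_def field_simps power2_eq_square)
        also have "\<dots> \<le> C * inc h x y + C * (\<delta> * S x y)"
          using m M0 \<delta> by (intro add_mono mult_right_mono) (auto simp: C_def S_def)
        finally show ?thesis by (simp add: R_def algebra_simps)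
      qed
      then have "var_bound p (inc (w H)) (C powr p * (\<delta> powr p * W))"
        using p C R0 by (intro var_bound_linear[OF _ _ _ _ vbR]) auto
      then show ?thesis using \<delta>p by (rule var_bound_weaken)
    qed
    show "\<exists>a b. (\<forall>x\<in>{0..1}. (F x + a x) * (G x + b x) = F x * G x + h x) \<and>
      (\<forall>x. norm (a x) \<le> e \<and> norm (b x) \<le> e) \<and> (\<forall>x. x \<notin> {0..1} \<longrightarrow> a x = 0 \<and> b x = 0) \<and>
      var_bound p (inc a) e \<and> var_bound p (inc b) e"
    proof (rule exI[of _ "w G"], rule exI[of _ "w F"], intro conjI ballI allI)
      fix x :: real assume x: "x \<in> {0..1}"
      have "(F x + t x * k (G x)) * (G x + t x * k (F x)) = F x * G x + (t x * D x + (t x)\<^sup>2 * E x)"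
        unfolding D_def E_def by (simp add: algebra_simps power2_eq_square)
      then show "(F x + w G x) * (G x + w F x) = F x * G x + h x"
        using x t(2)[OF x] by (simp add: w_def)
    qed (use w_norm w_vb M in \<open>auto simp: w_def S_def\<close>)
  qed
qed

lemma bvp_mult_openI:
  fixes k :: "'a \<Rightarrow> 'a::{euclidean_space, real_normed_field}"
  assumes k: "\<And>z. norm (k z) = norm z" "\<And>z w. k (z - w) = k z - k w"
    "\<And>z. z * k z = of_real ((norm z)\<^sup>2)"
    and p: "1 \<le> p"
  shows "bvp_mult_open p TYPE(real \<Rightarrow> 'a)"
  unfolding bvp_mult_open_def
proof (intro ballI allI impI)
  fix F G :: "real \<Rightarrow> 'a" and \<epsilon> :: real
  assume F: "F \<in> BVp p" and G: "G \<in> BVp p" and \<epsilon>: "0 < \<epsilon>"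
  have p0: "0 < p" using p by simp
  obtain K L where K: "var_bound p (inc F) K" and L: "var_bound p (inc G) L"
    using F G by (auto simp: BVp_iff)
  \<comment> \<open>Each factor is moved twice by at most \<open>e\<close>. Two such errors fit into
    \<open>\<epsilon> / 3\<close> in sup norm and, with the factor \<open>2 powr p\<close> of
    \<open>add\<close>, into \<open>(\<epsilon> / 3) powr p\<close> in variation.\<close>
  define e where "e = min (\<epsilon> / 6) ((\<epsilon> / 3) powr p / (2 powr p * 2))"
  have e: "0 < e" "2 * e \<le> \<epsilon> / 3" using \<epsilon> by (auto simp: e_def)
  have "e \<le> (\<epsilon> / 3) powr p / (2 powr p * 2)" by (simp add: e_def)
  then have ep: "2 powr p * (e + e) \<le> (\<epsilon> / 3) powr p" by (simp add: field_simps)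
  have add: "var_bound p (inc (\<lambda>x. f x + g x)) (2 powr p * (A + B))"
    if "var_bound p (inc f) A" "var_bound p (inc g) B" for f g :: "real \<Rightarrow> 'a" and A B
    using p that by (intro var_bound_mono[OF _ _ _ var_bound_add[OF _ _ _ that]])
      (auto simp: add_diff_add norm_triangle_ineq)
  have near: "(\<lambda>x. f' x + a x) \<in> bvp_ball p f \<epsilon>"
    if f: "f \<in> BVp p" and out: "\<And>x. x \<notin> {0..1} \<Longrightarrow> f' x = f x" "\<And>x. x \<notin> {0..1} \<Longrightarrow> a x = 0"
      and f': "var_bound p (inc f') A" "\<And>x. norm (f' x - f x) \<le> e"
        "var_bound p (inc (\<lambda>x. f' x - f x)) e"
      and a: "\<And>x. norm (a x) \<le> e" "var_bound p (inc a) e" for f f' a :: "real \<Rightarrow> 'a" and A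
  proof -
    have "(\<lambda>x. f' x + a x) \<in> BVp p"
      using add[OF f'(1) a(2)] f out by (auto simp: BVp_iff)
    moreover have "bvp_norm p (\<lambda>x. f x - (f' x + a x)) < \<epsilon>"
    proof (rule bvp_norm_less[OF p0 \<epsilon>])
      show "norm (f x - (f' x + a x)) \<le> \<epsilon> / 3" for x
        using norm_triangle_ineq[of "f' x - f x" "a x"] f'(2)[of x] a(1)[of x] e(2)
          norm_minus_commute[of "f x" "f' x + a x"] by (simp add: algebra_simps)
      have "inc (\<lambda>x. f x - (f' x + a x)) = inc (\<lambda>x. (f' x - f x) + a x)"
        by (intro ext, subst norm_minus_commute) (simp add: algebra_simps)
      then show "var_bound p (inc (\<lambda>x. f x - (f' x + a x))) ((\<epsilon> / 3) powr p)"
        using var_bound_weaken[OF add[OF f'(3) a(2)] ep] by simp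
    qed
    ultimately show ?thesis by (simp add: bvp_ball_def)
  qed
  show "\<exists>\<delta>>0. bvp_ball p (\<lambda>x. F x * G x) \<delta> \<subseteq>
    {\<lambda>x. c x * d x | c d. c \<in> bvp_ball p F \<epsilon> \<and> d \<in> bvp_ball p G \<epsilon>}"
  proof (rule nondegenerate_factorization[OF p K L e(1)])
    fix F' G' c assume c: "0 < c" "\<And>x. F' x * G' x = F x * G x"
      "\<And>x. x \<in> {0..1} \<Longrightarrow> c \<le> norm (F' x) + norm (G' x)"
      "\<And>x. x \<notin> {0..1} \<Longrightarrow> F' x = F x" "\<And>x. x \<notin> {0..1} \<Longrightarrow> G' x = G x"
      "\<And>x. norm (F' x - F x) \<le> e" "\<And>x. norm (G' x - G x) \<le> e"
      "var_bound p (inc (\<lambda>x. F' x - F x)) e" "var_bound p (inc (\<lambda>x. G' x - G x)) e"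
    obtain K' where K': "var_bound p (inc F') K'" using add[OF K c(8)] by auto
    obtain L' where L': "var_bound p (inc G') L'" using add[OF L c(9)] by auto
    define M where "M = max (norm (F' 0) + K' powr (1 / p)) (norm (G' 0) + L' powr (1 / p))"
    have M: "norm (F' x) \<le> M" "norm (G' x) \<le> M" if "x \<in> {0..1}" for x
      using var_bound_pointwise[OF K' p0 that] var_bound_pointwise[OF L' p0 that] by (auto simp: M_def)
    show ?thesis
    proof (rule nondegenerate_perturbation[OF k p K' L' M c(1,3) e(1)])
      fix \<delta> assume \<delta>: "0 < \<delta>" "\<And>h. (\<And>x. x \<in> {0..1} \<Longrightarrow> norm (h x) \<le> \<delta>) \<Longrightarrow>
        var_bound p (inc h) (\<delta> powr p) \<Longrightarrow>
        \<exists>a b. (\<forall>x\<in>{0..1}. (F' x + a x) * (G' x + b x) = F' x * G' x + h x) \<and>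
          (\<forall>x. norm (a x) \<le> e \<and> norm (b x) \<le> e) \<and> (\<forall>x. x \<notin> {0..1} \<longrightarrow> a x = 0 \<and> b x = 0) \<and>
          var_bound p (inc a) e \<and> var_bound p (inc b) e"
      have "bvp_ball p (\<lambda>x. F x * G x) \<delta> \<subseteq>
        {\<lambda>x. c x * d x | c d. c \<in> bvp_ball p F \<epsilon> \<and> d \<in> bvp_ball p G \<epsilon>}"
      proof
        fix H assume "H \<in> bvp_ball p (\<lambda>x. F x * G x) \<delta>"
        then have H: "H \<in> BVp p" "bvp_norm p (\<lambda>x. F x * G x - H x) < \<delta>"
          by (auto simp: bvp_ball_def)
        obtain J where J: "var_bound p (inc H) J" using H(1) by (auto simp: BVp_iff)
        have M0: "0 \<le> M" using order_trans[OF norm_ge_zero M(1)[of 0]] by simp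
        \<comment> \<open>Only finiteness is at stake: \<open>bvp_norm_lessD\<close> asks for some
          bound on the variation of \<open>F G - H\<close>. It is obtained from \<open>F'\<close>
          and \<open>G'\<close>, which \<open>M\<close> bounds and whose product is
          \<open>F G\<close>.\<close>
        have FG: "inc (\<lambda>x. F' x * G' x) x y \<le> M * (inc F' x y + inc G' x y)"
          if "x \<in> {0..1}" "y \<in> {0..1}" for x y
        proof -
          have "inc (\<lambda>x. F' x * G' x) x y \<le> inc F' x y * norm (G' x) + norm (F' y) * inc G' x y"
            by (rule norm_mult_diff_le)
          also have "\<dots> \<le> inc F' x y * M + M * inc G' x y"
            using M that by (intro add_mono mult_left_mono mult_right_mono) auto
          finally show ?thesis by (simp add: algebra_simps)
        qed
        have "var_bound p (\<lambda>x y. inc F' x y + inc G' x y) (2 powr p * (K' + L'))"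
          using p K' L' by (intro var_bound_add) auto
        then have "var_bound p (inc (\<lambda>x. F' x * G' x)) (M powr p * (2 powr p * (K' + L')))"
          using p M0 FG by (elim var_bound_linear[rotated 4]) auto
        then have vFG: "var_bound p (inc (\<lambda>x. F x * G x)) (M powr p * (2 powr p * (K' + L')))"
          unfolding c(2) .
        have "inc (\<lambda>x. - H x) = inc H" by (intro ext) (simp add: norm_minus_commute)
        then have "\<exists>A. var_bound p (inc (\<lambda>x. F x * G x - H x)) A"
          using add[OF vFG, of "\<lambda>x. - H x" J] J by auto
        then obtain A where "var_bound p (inc (\<lambda>x. F x * G x - H x)) A" ..
        note small = bvp_norm_lessD[OF p0 this H(2)]
        define h where "h x = H x - F x * G x" for x
        have "inc h = inc (\<lambda>x. F x * G x - H x)"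
          by (intro ext, subst norm_minus_commute) (simp add: h_def algebra_simps)
        then have "var_bound p (inc h) (\<delta> powr p)" using small(2) by simp
        moreover have "norm (h x) \<le> \<delta>" if "x \<in> {0..1}" for x
          using small(1)[OF that] by (simp add: h_def norm_minus_commute)
        ultimately obtain a b where
          ab: "\<forall>x\<in>{0..1}. (F' x + a x) * (G' x + b x) = F' x * G' x + h x"
            "\<forall>x. norm (a x) \<le> e \<and> norm (b x) \<le> e" "\<forall>x. x \<notin> {0..1} \<longrightarrow> a x = 0 \<and> b x = 0"
            "var_bound p (inc a) e" "var_bound p (inc b) e"
          using \<delta>(2)[of h] by blast
        have "(\<lambda>x. F' x + a x) \<in> bvp_ball p F \<epsilon>" "(\<lambda>x. G' x + b x) \<in> bvp_ball p G \<epsilon>"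
          using ab c K' L' F G by (auto intro!: near)
        moreover have "H = (\<lambda>x. (F' x + a x) * (G' x + b x))"
        proof
          fix x
          show "H x = (F' x + a x) * (G' x + b x)"
          proof (cases "x \<in> {0..1}")
            case True
            then show ?thesis using ab(1) c(2)[of x] by (simp add: h_def)
          next
            case False
            then show ?thesis using ab(3) c(4)[of x] F H(1) by (auto simp: BVp_iff)
          qed
        qed
        ultimately show "H \<in> {\<lambda>x. c x * d x | c d. c \<in> bvp_ball p F \<epsilon> \<and> d \<in> bvp_ball p G \<epsilon>}"
          by (intro CollectI exI conjI)
      qed
      then show ?thesis using \<delta>(1) by blast
    qed
  qed
qed

theorem theorem1p1:
  fixes p :: real
  assumes "1 \<le> p"
  shows "bvp_mult_open p TYPE(real \<Rightarrow> real) \<and> bvp_mult_open p TYPE(real \<Rightarrow> complex)"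
proof
  show "bvp_mult_open p TYPE(real \<Rightarrow> real)"
    by (rule bvp_mult_openI[of "\<lambda>z. z"]) (use assms in \<open>auto simp: power2_eq_square\<close>)
  show "bvp_mult_open p TYPE(real \<Rightarrow> complex)"
    by (rule bvp_mult_openI[of cnj]) (use assms in \<open>auto simp: complex_norm_square simp flip: of_real_power\<close>)
qed

end
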